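(* There exists $\rho > 0$ such that the following holds for every $\mu > 0$ and every $\Delta_0$ sufficiently large (in terms of $\mu$). Let $G$ be a graph of maximum degree $\Delta \geq \Delta_0$ and let $\mathbf{k} : V(G) \to \mathbb{R}$, $\mathbf{r} : V(G) \to \mathbb{N}$, and $\boldsymbol{\varepsilon} : V(G) \to [0,1]$ be such that $G$ is $(\mathbf{k}, \mathbf{r})$-locally-sparse. Let $\varepsilon_{\max} = \max_u \boldsymbol{\varepsilon}(u)$ and $r_{\max} = \max_u \mathbf{r}(u)$. Suppose the following hold for each $v \in V(G)$: (1) $\deg(v) \geq \Delta^{\min\{2\varepsilon_{\max},\, (1+\varepsilon_{\max})/2\}} \left(\log(8\Delta^4)\right)^{r_{\max}}$, and (2) $3 \leq \mathbf{r}(v) \leq \rho \log\log \deg(v) / \log\log\log \deg(v)$ and $\mathbf{k}(v) = \deg(v)^{\boldsymbol{\varepsilon}(v) \mathbf{r}(v)}$. If $\mathcal{H} = (L, H)$ is a correspondence cover of $G$ satisfying, for all $u \in V(G)$, \[|L(u)| \geq (1+\mu) \min\left\{2,\, \frac{1+\varepsilon_{\max}}{1-\varepsilon_{\max}}\right\} \deg(u) \left(\boldsymbol{\varepsilon}(u) + \frac{\mathbf{r}(u) \log\log \deg(u)}{\log \deg(u)}\right),\] then $G$ admits a proper $\mathcal{H}$-coloring.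
   Context: All graphs are finite, undirected, and simple; $\log$ is the natural logarithm. For $k \in \mathbb{R}$ and $r \in \mathbb{N}$, a graph is $(k,r)$-sparse if it contains at most $\lfloor k \rfloor$ copies of the complete graph $K_r$ (subgraphs isomorphic to $K_r$, not necessarily vertex-disjoint). Given $\mathbf{k} : V(G) \to \mathbb{R}$ and $\mathbf{r} : V(G) \to \mathbb{N}$, a graph $G$ is $(\mathbf{k}, \mathbf{r})$-locally-sparse if for every $v \in V(G)$ the induced subgraph $G[N(v)]$ is $(\mathbf{k}(v), \mathbf{r}(v))$-sparse. A correspondence cover of $G$ is a pair $\mathcal{H} = (L, H)$, where $H$ is a graph and $L : V(G) \to 2^{V(H)}$, such that: the sets $\{L(v) : v \in V(G)\}$ form a partition of $V(H)$; for each $v \in V(G)$, $L(v)$ is an independent set in $H$; for each $u, v \in V(G)$, the edges of $H[L(u) \cup L(v)]$ form a matching, which is empty whenever $uv \notin E(G)$. An $\mathcal{H}$-coloring is a map $\varphi : V(G) \to V(H)$ with $\varphi(v) \in L(v)$ for all $v$; it is proper if its image is an independent set in $H$. When $\varepsilon_{\max} = 1$ the expression $\min\{2, (1+\varepsilon_{\max})/(1-\varepsilon_{\max})\}$ is interpreted as $2$. *)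

theory Defs
  imports "HOL-Analysis.Analysis" "Graph_Theory.Graph_Theory"
begin

text \<open>
  A finite simple undirected graph is a \<^locale>\<open>pair_graph\<close>: a finite, loop-free, symmetric
  digraph without parallel arcs, so that an undirected edge \<open>uv\<close> is the pair of arcs
  \<open>(u, v)\<close>, \<open>(v, u)\<close>. In particular \<^const>\<open>out_degree\<close> is the degree.
\<close>

definition neighborhood :: "('a, 'b) pre_digraph \<Rightarrow> 'a \<Rightarrow> 'a set" where
  "neighborhood G v = {u. v \<rightarrow>\<^bsub>G\<^esub> u}"

definition max_degree :: "('a, 'b) pre_digraph \<Rightarrow> nat" where
  "max_degree G = Max (out_degree G ` verts G)"

definition edge_set :: "('a, 'b) pre_digraph \<Rightarrow> 'a set set" where
  "edge_set G = {{u, v} | u v. u \<rightarrow>\<^bsub>G\<^esub> v}"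

definition independent_set :: "('a, 'b) pre_digraph \<Rightarrow> 'a set \<Rightarrow> bool" where
  "independent_set G S \<longleftrightarrow> S \<subseteq> verts G \<and> (\<forall>u\<in>S. \<forall>v\<in>S. \<not> u \<rightarrow>\<^bsub>G\<^esub> v)"

text \<open>
  \<^const>\<open>complete_digraph\<close> takes only graphs, hence symmetric digraphs, and \<^const>\<open>subgraph\<close>
  fixes the tail and head maps of the subgraph, so every undirected copy of the complete graph
  on \<open>r\<close> vertices is counted exactly once.
\<close>

definition clique_copies :: "('a, 'b) pre_digraph \<Rightarrow> nat \<Rightarrow> ('a, 'b) pre_digraph set" where
  "clique_copies G r = {K. subgraph K G \<and> complete_digraph r K}"

definition sparse :: "real \<Rightarrow> nat \<Rightarrow> ('a, 'b) pre_digraph \<Rightarrow> bool" where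
  "sparse k r G \<longleftrightarrow> int (card (clique_copies G r)) \<le> \<lfloor>k\<rfloor>"

definition locally_sparse ::
  "('a \<Rightarrow> real) \<Rightarrow> ('a \<Rightarrow> nat) \<Rightarrow> ('a, 'b) pre_digraph \<Rightarrow> bool" where
  "locally_sparse k r G \<longleftrightarrow> (\<forall>v\<in>verts G. sparse (k v) (r v) (G \<restriction> neighborhood G v))"

text \<open>
  The lists are a partition of the vertices of \<open>H\<close> as an indexed family: lists of distinct
  vertices are disjoint.
\<close>

definition correspondence_cover ::
  "'a pair_pre_digraph \<Rightarrow> ('a \<Rightarrow> 'c set) \<Rightarrow> 'c pair_pre_digraph \<Rightarrow> bool" where
  "correspondence_cover G L H \<longleftrightarrow>
     pair_graph H \<and>
     (\<Union>v\<in>pverts G. L v) = pverts H \<and>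
     disjoint_family_on L (pverts G) \<and>
     (\<forall>v\<in>pverts G. L v \<noteq> {}) \<and>
     (\<forall>v\<in>pverts G. independent_set (with_proj H) (L v)) \<and>
     (\<forall>u\<in>pverts G. \<forall>v\<in>pverts G.
        pairwise disjnt (edge_set (with_proj H \<restriction> (L u \<union> L v))) \<and>
        (\<not> u \<rightarrow>\<^bsub>with_proj G\<^esub> v \<longrightarrow> edge_set (with_proj H \<restriction> (L u \<union> L v)) = {}))"

definition cover_coloring ::
  "'a pair_pre_digraph \<Rightarrow> ('a \<Rightarrow> 'c set) \<Rightarrow> ('a \<Rightarrow> 'c) \<Rightarrow> bool" where
  "cover_coloring G L \<phi> \<longleftrightarrow> (\<forall>v\<in>pverts G. \<phi> v \<in> L v)"

definition proper_cover_coloring ::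
  "'a pair_pre_digraph \<Rightarrow> ('a \<Rightarrow> 'c set) \<Rightarrow> 'c pair_pre_digraph \<Rightarrow> ('a \<Rightarrow> 'c) \<Rightarrow> bool" where
  "proper_cover_coloring G L H \<phi> \<longleftrightarrow>
     cover_coloring G L \<phi> \<and> independent_set (with_proj H) (\<phi> ` pverts G)"

text \<open>
  The factor \<open>min {2, (1 + e) / (1 - e)}\<close>, read as \<open>2\<close> at \<open>e = 1\<close>, where division by zero
  would otherwise yield \<open>0\<close>.
\<close>

definition list_factor :: "real \<Rightarrow> real" where
  "list_factor e = (if e = 1 then 2 else min 2 ((1 + e) / (1 - e)))"

end

(*
  The proof counts colourings in the style of Rosenfeld: by induction on S, for v outside S,
  col(S + v) >= beta_v * col(S), where beta_v = delta^2 |L(v)| / (4 Q_v). This says that in a uniformly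
  random colouring of S the vertex v has at least beta_v available colours on average. The induction
  hypothesis gives P(u has fewer than theta available colours) <= theta / beta_u, so almost all neighbours
  can be recoloured in many ways.

  Fix c in L(v) and consider the random set J of neighbours of v whose colour conflicts with c.
  Recolouring J shows that, relative to the colourings with empty J, the set J is distributed like a
  hard-core independent set in which u has fugacity about 1 / (number of available colours of u). As the
  neighbourhood has few r-cliques, Ramsey's theorem and supersaturation give large independent sets,
  so either the total fugacity is small or J is almost surely larger than a threshold t. At most
  deg(v) / t colours are of the second kind, since each neighbour blocks at most one colour of v; every
  other colour is available with probability about 1 / Q_v. The argument needs no uniform lower bound on
  the beta_u beyond a constant times (log Delta)^2, which is what condition (1) provides.
*)

theory Submission
  imports Defs "HOL-Real_Asymp.Real_Asymp"
begin

section \<open>Independent sets in graphs with few cliques\<close>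

text \<open>The threshold \<open>t\<close> is dictated by the lists: about \<open>d / t\<close>
  colours are given up, so \<open>t\<close> has to be slightly below \<open>ln d / w\<close> with
  \<open>w = e * ln d + r * ln (ln d)\<close>. Availability then costs a factor \<open>Q\<close> of
  about \<open>(n / t) ^ t\<close>, where \<open>n\<close> is the size that forces an independent
  set. Since \<open>ln n\<close> is about \<open>w\<close>, this is \<open>d\<close> to a power just
  below 1, and \<open>beta_v\<close> is at least a small power of \<open>d\<close>. The obstacle is
  a neighbour \<open>u\<close> whose degree is only polylogarithmic in Delta, for a small power of
  \<open>deg u\<close> need not exceed \<open>(log Delta)^2\<close>. Two spare logarithms help:
  Ramsey's bound has exponent \<open>r - 1\<close> instead of \<open>r\<close>, and the division by
  \<open>t\<close> removes another factor of about \<open>ln d\<close>. So \<open>ln (n / t)\<close>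
  is about \<open>w - 2 * ln (ln d)\<close>, which for negligible \<open>e\<close> lowers
  \<open>Q\<close> by a factor of about \<open>d\<close> to the power \<open>2 / r\<close>; a degree
  of at least \<open>(log Delta)^r\<close> turns this into the missing \<open>(log Delta)^2\<close>.
  The base 4 in the weighted sums is the quotient of \<open>2 / A\<close> and
  \<open>1 / (2 * A)\<close>, the bounds that recolouring in the two directions gives at a vertex
  with \<open>A\<close> available colours.\<close>

lemma ramsey_clique_or_independent:
  fixes E :: "'a \<Rightarrow> 'a \<Rightarrow> bool"
  assumes "finite W" "a ^ (r - 1) \<le> card W" "1 \<le> r" "symp E"
  shows "(\<exists>K\<subseteq>W. card K = r \<and> pairwise E K) \<or>
    (\<exists>I\<subseteq>W. card I = a \<and> pairwise (\<lambda>u w. \<not> E u w) I)"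
  using assms(1-3)
proof (induction r arbitrary: W a)
  case 0
  then show ?case by simp
next
  case (Suc r)
  note outer = Suc.IH
  show ?case
  proof (cases "r = 0")
    case True
    with Suc.prems obtain x where "x \<in> W" by (cases "W = {}") auto
    then have "{x} \<subseteq> W" "card {x} = Suc r" "pairwise E {x}" using True by auto
    then show ?thesis by blast
  next
    case False
    show ?thesis using Suc.prems(1,2)
    proof (induction a arbitrary: W)
      case 0
      have "card {} = (0::nat)" "pairwise (\<lambda>u w. \<not> E u w) ({}::'a set)" by auto
      then show ?case by blast
    next
      case (Suc a)
      have "0 < card W" using less_le_trans[OF _ Suc.prems(2), of 0] by simp
      then obtain x where x: "x \<in> W" by (metis card_gt_0_iff ex_in_conv)
      let ?A = "{w \<in> W - {x}. E x w}" and ?B = "{w \<in> W - {x}. \<not> E x w}"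
      have "card ?A + card ?B = card (?A \<union> ?B)"
        using Suc.prems(1) by (intro card_Un_disjoint[symmetric]) auto
      also have "?A \<union> ?B = W - {x}" by auto
      finally have AB: "card ?A + card ?B + 1 = card W"
        using x Suc.prems(1) \<open>0 < card W\<close> by (simp add: card_Diff_singleton)
      have "Suc a ^ r = a * Suc a ^ (r - 1) + Suc a ^ (r - 1)"
        using False by (cases r) auto
      moreover have "a ^ r \<le> a * Suc a ^ (r - 1)"
        using False by (cases r) (auto intro: power_mono)
      \<comment> \<open>The recursion of the bound: one vertex is split off, and either
        \<open>Suc a ^ (r - 1)\<close> neighbours remain, where a smaller clique suffices, or
        \<open>a ^ r\<close> non-neighbours, where a smaller independent set does. The split vertex
        costs nothing, because the first alternative fails strictly.\<close>
      ultimately have pw: "a ^ r + Suc a ^ (r - 1) \<le> Suc a ^ r" by linarith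
      show ?case
      proof (cases "Suc a ^ (r - 1) \<le> card ?A")
        case True
        have "(\<exists>K\<subseteq>?A. card K = r \<and> pairwise E K) \<or>
            (\<exists>I\<subseteq>?A. card I = Suc a \<and> pairwise (\<lambda>u w. \<not> E u w) I)"
          using outer[of ?A "Suc a"] True False Suc.prems(1) by simp
        then show ?thesis
        proof
          assume "\<exists>K\<subseteq>?A. card K = r \<and> pairwise E K"
          then obtain K where K: "K \<subseteq> ?A" "card K = r" "pairwise E K" by blast
          have "pairwise E (insert x K)"
            using K \<open>symp E\<close> by (auto simp: pairwise_insert dest: sympD)
          moreover have "card (insert x K) = Suc r"
            using K Suc.prems(1) finite_subset[OF K(1)] by (subst card_insert_disjoint) auto
          moreover have "insert x K \<subseteq> W" using K x by auto
          ultimately show ?thesis by blast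
        next
          assume "\<exists>I\<subseteq>?A. card I = Suc a \<and> pairwise (\<lambda>u w. \<not> E u w) I"
          then show ?thesis by blast
        qed
      next
        case False
        then have "a ^ r \<le> card ?B" using AB pw Suc.prems(2) by simp
        then have "(\<exists>K\<subseteq>?B. card K = Suc r \<and> pairwise E K) \<or>
            (\<exists>I\<subseteq>?B. card I = a \<and> pairwise (\<lambda>u w. \<not> E u w) I)"
          using Suc.IH[of ?B] Suc.prems(1) by simp
        then show ?thesis
        proof
          assume "\<exists>K\<subseteq>?B. card K = Suc r \<and> pairwise E K"
          then show ?thesis by blast
        next
          assume "\<exists>I\<subseteq>?B. card I = a \<and> pairwise (\<lambda>u w. \<not> E u w) I"
          then obtain I where I: "I \<subseteq> ?B" "card I = a" "pairwise (\<lambda>u w. \<not> E u w) I" by blast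
          have "pairwise (\<lambda>u w. \<not> E u w) (insert x I)"
            using I \<open>symp E\<close> by (auto simp: pairwise_insert dest: sympD)
          moreover have "card (insert x I) = Suc a"
            using I Suc.prems(1) finite_subset[OF I(1)] by (subst card_insert_disjoint) auto
          moreover have "insert x I \<subseteq> W" using I x by auto
          ultimately show ?thesis by blast
        qed
      qed
    qed
  qed
qed

text \<open>The quotient of the two binomials is the probability that a random
  \<open>N\<close>-subset of an \<open>m\<close>-set contains \<open>r\<close> given points. It is a
  product of factors \<open>(N - i) / (m - i)\<close>, each at most \<open>N / m\<close>.\<close>

lemma power_mult_binomial_le:
  assumes "r \<le> N" "N \<le> m"
  shows "m ^ r * ((m - r) choose (N - r)) \<le> N ^ r * (m choose N)"
  using assms
proof (induction r arbitrary: m N)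
  case 0
  then show ?case by simp
next
  case (Suc r)
  then obtain M K where mN: "m = Suc M" "N = Suc K" by (cases m; cases N) auto
  have IH: "M ^ r * ((M - r) choose (K - r)) \<le> K ^ r * (M choose K)"
    using Suc by (auto simp: mN)
  have step: "Suc M ^ r * K ^ r \<le> Suc K ^ r * M ^ r"
    using Suc.prems by (auto simp: mN power_mult_distrib[symmetric] intro!: power_mono)
  show ?case
  proof (cases "K = 0")
    case True
    then show ?thesis using Suc.prems by (auto simp: mN)
  next
    case False
    have "K ^ r * (Suc M ^ r * ((M - r) choose (K - r)))
        \<le> Suc K ^ r * (M ^ r * ((M - r) choose (K - r)))"
      using mult_right_mono[OF step, of "(M - r) choose (K - r)"] by (simp add: ac_simps)
    also have "\<dots> \<le> Suc K ^ r * (K ^ r * (M choose K))" using IH by (rule mult_left_mono) simp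
    finally have *: "Suc M ^ r * ((M - r) choose (K - r)) \<le> Suc K ^ r * (M choose K)"
      using False by (simp add: ac_simps)
    have "m ^ Suc r * ((m - Suc r) choose (N - Suc r)) = Suc M * (Suc M ^ r * ((M - r) choose (K - r)))"
      by (simp add: mN algebra_simps)
    also have "\<dots> \<le> Suc M * (Suc K ^ r * (M choose K))" using * by (rule mult_left_mono) simp
    also have "\<dots> = Suc K ^ r * (Suc M * (M choose K))" by (simp only: ac_simps)
    also have "\<dots> = Suc K ^ r * (Suc K * (Suc M choose Suc K))"
      by (simp only: Suc_times_binomial_eq mult.commute)
    also have "\<dots> = N ^ Suc r * (m choose N)" by (simp only: mN power_Suc ac_simps)
    finally show ?thesis .
  qed
qed

lemma card_supersets_of_card:
  assumes "finite W" "K \<subseteq> W" "card K \<le> N"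
  shows "card {B. K \<subseteq> B \<and> B \<subseteq> W \<and> card B = N} = (card W - card K) choose (N - card K)"
proof -
  have fin: "finite K" using assms finite_subset by blast
  have "bij_betw (\<lambda>B. B - K) {B. K \<subseteq> B \<and> B \<subseteq> W \<and> card B = N} {C. C \<subseteq> W - K \<and> card C = N - card K}"
  proof (rule bij_betwI[where g = "\<lambda>C. C \<union> K"])
    show "(\<lambda>B. B - K) \<in> {B. K \<subseteq> B \<and> B \<subseteq> W \<and> card B = N} \<rightarrow> {C. C \<subseteq> W - K \<and> card C = N - card K}"
      using fin by (auto simp: card_Diff_subset)
    show "(\<lambda>C. C \<union> K) \<in> {C. C \<subseteq> W - K \<and> card C = N - card K} \<rightarrow> {B. K \<subseteq> B \<and> B \<subseteq> W \<and> card B = N}"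
    proof (rule Pi_I)
      fix C assume "C \<in> {C. C \<subseteq> W - K \<and> card C = N - card K}"
      then have C: "C \<subseteq> W - K" "card C = N - card K" by auto
      have "card (C \<union> K) = card C + card K"
        using C fin finite_subset[OF C(1)] assms(1) by (intro card_Un_disjoint) auto
      then show "C \<union> K \<in> {B. K \<subseteq> B \<and> B \<subseteq> W \<and> card B = N}" using C assms by auto
    qed
  qed auto
  then have "card {B. K \<subseteq> B \<and> B \<subseteq> W \<and> card B = N} = card {C. C \<subseteq> W - K \<and> card C = N - card K}"
    by (rule bij_betw_same_card)
  also have "\<dots> = (card W - card K) choose (N - card K)"
    using assms fin by (subst n_subsets) (auto simp: card_Diff_subset)
  finally show ?thesis .
qed

text \<open>Supersaturation: every subset of size \<open>a ^ (r - 1)\<close> contains an \<open>r\<close>-clique.\<close>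

lemma card_cliques_ge:
  fixes E :: "'a \<Rightarrow> 'a \<Rightarrow> bool"
  assumes W: "finite W" and E: "symp E" and ra: "1 \<le> r" "2 \<le> a"
    and m: "a ^ (r - 1) \<le> card W"
    and noI: "\<nexists>I. I \<subseteq> W \<and> card I = a \<and> pairwise (\<lambda>u w. \<not> E u w) I"
  shows "card W ^ r \<le> (a ^ (r - 1)) ^ r * card {K. K \<subseteq> W \<and> card K = r \<and> pairwise E K}"
proof -
  define N where "N = a ^ (r - 1)"
  define Q where "Q = {K. K \<subseteq> W \<and> card K = r \<and> pairwise E K}"
  have finQ: "finite Q" unfolding Q_def using W by simp
  \<comment> \<open>\<open>2 \<le> a\<close> makes the sampled sets at least as large as the
    cliques, so that the binomial to be cancelled at the end is positive.\<close>
  have "r - 1 < 2 ^ (r - 1)" by (rule less_exp)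
  also have "\<dots> \<le> a ^ (r - 1)" using ra by (intro power_mono) auto
  finally have rN: "r \<le> N" unfolding N_def using ra by linarith
  have Nm: "N \<le> card W" using m N_def by simp
  have "{B. B \<subseteq> W \<and> card B = N} \<subseteq> (\<Union>K\<in>Q. {B. K \<subseteq> B \<and> B \<subseteq> W \<and> card B = N})"
  proof
    fix B assume "B \<in> {B. B \<subseteq> W \<and> card B = N}"
    then have B: "B \<subseteq> W" "card B = N" by auto
    have "(\<exists>K\<subseteq>B. card K = r \<and> pairwise E K) \<or> (\<exists>I\<subseteq>B. card I = a \<and> pairwise (\<lambda>u w. \<not> E u w) I)"
      using B W ra E by (intro ramsey_clique_or_independent) (auto simp: N_def dest: finite_subset)
    then obtain K where "K \<subseteq> B" "card K = r" "pairwise E K" using noI B by blast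
    then show "B \<in> (\<Union>K\<in>Q. {B. K \<subseteq> B \<and> B \<subseteq> W \<and> card B = N})"
      using B by (auto simp: Q_def)
  qed
  then have "card {B. B \<subseteq> W \<and> card B = N} \<le> card (\<Union>K\<in>Q. {B. K \<subseteq> B \<and> B \<subseteq> W \<and> card B = N})"
    using W finQ by (intro card_mono) auto
  also have "\<dots> \<le> (\<Sum>K\<in>Q. card {B. K \<subseteq> B \<and> B \<subseteq> W \<and> card B = N})"
    using finQ by (rule card_UN_le)
  also have "\<dots> = (\<Sum>K\<in>Q. (card W - r) choose (N - r))"
    using W rN by (intro sum.cong refl) (auto simp: Q_def card_supersets_of_card)
  also have "\<dots> = card Q * ((card W - r) choose (N - r))" by simp
  finally have A: "(card W choose N) \<le> card Q * ((card W - r) choose (N - r))"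
    using W by (simp add: n_subsets)
  have "card W ^ r * ((card W - r) choose (N - r)) \<le> N ^ r * (card W choose N)"
    using rN Nm by (rule power_mult_binomial_le)
  also have "\<dots> \<le> N ^ r * (card Q * ((card W - r) choose (N - r)))"
    using A by (rule mult_left_mono) simp
  finally have "((card W - r) choose (N - r)) * card W ^ r \<le> ((card W - r) choose (N - r)) * (N ^ r * card Q)"
    by (simp add: ac_simps)
  moreover have "0 < (card W - r) choose (N - r)" using rN Nm by (simp add: diff_le_mono)
  ultimately have "card W ^ r \<le> N ^ r * card Q" by (simp del: binomial_eq_0_iff)
  then show ?thesis by (simp add: N_def Q_def)
qed

text \<open>Contrapositive of supersaturation: without an independent \<open>a\<close>-set there
  would be at least \<open>(card W / a ^ (r - 1)) ^ r > x ^ r\<close> cliques. The form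
  \<open>x ^ r\<close> fits the sparsity bound \<open>deg v powr (\<epsilon> v * r v)\<close>, with
  \<open>x = deg v powr \<epsilon> v\<close>.\<close>

lemma independent_of_few_cliques:
  fixes E :: "'a \<Rightarrow> 'a \<Rightarrow> bool" and x :: real
  assumes W: "finite W" and E: "symp E" and ra: "1 \<le> r" "2 \<le> a"
    and few: "real (card {K. K \<subseteq> W \<and> card K = r \<and> pairwise E K}) \<le> x ^ r"
    and x: "1 \<le> x" and m: "real a ^ (r - 1) * x < real (card W)"
  shows "\<exists>I. I \<subseteq> W \<and> card I = a \<and> pairwise (\<lambda>u w. \<not> E u w) I"
proof (rule ccontr)
  assume noI: "\<not> ?thesis"
  have "real a ^ (r - 1) * 1 \<le> real a ^ (r - 1) * x" using x by (intro mult_left_mono) auto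
  with m have "real a ^ (r - 1) \<le> real (card W)" by linarith
  then have "real (a ^ (r - 1)) \<le> real (card W)" by simp
  then have "a ^ (r - 1) \<le> card W" by (simp only: of_nat_le_iff)
  from card_cliques_ge[OF W E ra this] noI
  have "card W ^ r \<le> (a ^ (r - 1)) ^ r * card {K. K \<subseteq> W \<and> card K = r \<and> pairwise E K}" by blast
  then have "real (card W ^ r) \<le> real ((a ^ (r - 1)) ^ r * card {K. K \<subseteq> W \<and> card K = r \<and> pairwise E K})"
    by (simp only: of_nat_le_iff)
  then have "real (card W) ^ r \<le> (real a ^ (r - 1)) ^ r * real (card {K. K \<subseteq> W \<and> card K = r \<and> pairwise E K})"
    by simp
  also have "\<dots> \<le> (real a ^ (r - 1)) ^ r * x ^ r" using few by (intro mult_left_mono) auto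
  also have "\<dots> = (real a ^ (r - 1) * x) ^ r" by (simp add: power_mult_distrib)
  also have "\<dots> < real (card W) ^ r" using m x ra by (intro power_strict_mono) auto
  finally show False by simp
qed

section \<open>Weighted counts of small independent sets\<close>

text \<open>The summand is the probability that independent choices with probabilities
  \<open>p u\<close> produce exactly \<open>Y\<close>. Once the factor of \<open>J\<close> is taken
  out, the remaining choices have total probability 1.\<close>

lemma sum_Pow_prod_bernoulli:
  fixes p :: "'a \<Rightarrow> real"
  assumes U: "finite U" and J: "J \<subseteq> U"
  shows "(\<Sum>Y\<in>{Y. J \<subseteq> Y \<and> Y \<subseteq> U}. prod p Y * (\<Prod>u\<in>U - Y. 1 - p u)) = prod p J"
proof -
  have fin: "finite J" using U J finite_subset by blast
  have "(\<Sum>Y\<in>{Y. J \<subseteq> Y \<and> Y \<subseteq> U}. prod p Y * (\<Prod>u\<in>U - Y. 1 - p u))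
      = (\<Sum>Y\<in>Pow (U - J). prod p J * (prod p Y * (\<Prod>u\<in>(U - J) - Y. 1 - p u)))"
  proof (rule sum.reindex_bij_witness[where i = "\<lambda>Y. J \<union> Y" and j = "\<lambda>Y. Y - J"])
    fix Y assume Y: "Y \<in> {Y. J \<subseteq> Y \<and> Y \<subseteq> U}"
    then have "finite Y" using U finite_subset by blast
    then have "prod p Y = prod p J * prod p (Y - J)"
      using Y fin by (subst mult.commute, subst prod.subset_diff[of J Y]) auto
    moreover have "(U - J) - (Y - J) = U - Y" using Y by auto
    ultimately show "prod p J * (prod p (Y - J) * (\<Prod>u\<in>(U - J) - (Y - J). 1 - p u))
        = prod p Y * (\<Prod>u\<in>U - Y. 1 - p u)" by simp
  qed (use J in auto)
  also have "\<dots> = prod p J * (\<Prod>u\<in>U - J. p u + (1 - p u))"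
    using U by (subst prod_add) (auto simp: sum_distrib_left)
  finally show ?thesis by simp
qed

text \<open>A random subset with inclusion probabilities \<open>p\<close> of expected size \<open>4 n\<close> has at least \<open>n\<close> elements with
  probability at least 1/2, and its expected number of members of \<open>F\<close> is the left-hand side.\<close>

lemma sum_prod_hitting_family:
  fixes p :: "'a \<Rightarrow> real"
  assumes U: "finite U" and p: "\<And>u. u \<in> U \<Longrightarrow> 0 \<le> p u \<and> p u \<le> 1"
    and total: "sum p U = 4 * real n" and n: "1 \<le> n"
    and hit: "\<And>Y. Y \<subseteq> U \<Longrightarrow> n \<le> card Y \<Longrightarrow> \<exists>J\<in>F. J \<subseteq> Y"
    and F: "F \<subseteq> Pow U"
  shows "1 / 2 \<le> (\<Sum>J\<in>F. prod p J)"
proof -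
  let ?P = "\<lambda>Y. prod p Y * (\<Prod>u\<in>U - Y. 1 - p u)"
  have finF: "finite F" using F U finite_subset by blast
  have P0: "0 \<le> ?P Y" if "Y \<subseteq> U" for Y
    using p that by (intro mult_nonneg_nonneg prod_nonneg) force+
  have total1: "(\<Sum>Y\<in>Pow U. ?P Y) = 1"
    using U by (subst prod_add[symmetric]) auto
  \<comment> \<open>Lower tail by an exponential moment: the mean of \<open>(1 / 2) ^ card Y\<close>
    is at most \<open>exp (- sum p U / 2) = exp (- 2 * n)\<close>, and every \<open>Y\<close> with
    fewer than \<open>n\<close> elements has
    \<open>(1 / 2) ^ card Y \<ge> (1 / 2) ^ n\<close>.\<close>
  have "(\<Sum>Y\<in>Pow U. (1 / 2) ^ card Y * ?P Y) = (\<Prod>u\<in>U. p u / 2 + (1 - p u))"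
    using U by (subst prod_add) (auto intro!: sum.cong simp: prod_dividef field_simps)
  also have "\<dots> = (\<Prod>u\<in>U. 1 - p u / 2)" by (intro prod.cong) (auto simp: field_simps)
  also have "\<dots> \<le> (\<Prod>u\<in>U. exp (- (p u / 2)))"
  proof (rule prod_mono)
    fix u assume "u \<in> U"
    then show "0 \<le> 1 - p u / 2 \<and> 1 - p u / 2 \<le> exp (- (p u / 2))"
      using p[of u] exp_ge_add_one_self[of "- (p u / 2)"] by auto
  qed
  also have "\<dots> = exp (- 2 * real n)"
    using U total by (simp add: exp_sum[symmetric] sum_negf sum_divide_distrib[symmetric])
  finally have tail: "(\<Sum>Y\<in>Pow U. (1 / 2) ^ card Y * ?P Y) \<le> exp (- 2 * real n)" .
  have "(1 / 2) ^ n * (\<Sum>Y\<in>{Y\<in>Pow U. card Y < n}. ?P Y) \<le> (\<Sum>Y\<in>{Y\<in>Pow U. card Y < n}. (1 / 2) ^ card Y * ?P Y)"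
    unfolding sum_distrib_left
    by (intro sum_mono mult_right_mono power_decreasing P0) auto
  also have "\<dots> \<le> (\<Sum>Y\<in>Pow U. (1 / 2) ^ card Y * ?P Y)"
    using U P0 by (intro sum_mono2) auto
  finally have "(1 / 2) ^ n * (\<Sum>Y\<in>{Y\<in>Pow U. card Y < n}. ?P Y) \<le> exp (- 2 * real n)" using tail by simp
  then have "(\<Sum>Y\<in>{Y\<in>Pow U. card Y < n}. ?P Y) \<le> 2 ^ n * exp (- 2 * real n)"
    by (simp add: field_simps)
  also have "\<dots> = (2 * exp (- 2)) ^ n"
    by (simp add: power_mult_distrib exp_of_nat_mult[symmetric] mult.commute)
  also have "\<dots> \<le> (1 / 2) ^ n"
  proof (rule power_mono)
    have "4 \<le> exp (2::real)"
      using exp_ge_add_one_self[of "1::real"] power_mono[of 2 "exp (1::real)" 2]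
      by (simp add: exp_double[symmetric] power2_eq_square exp_add[symmetric])
    then show "2 * exp (- 2) \<le> 1 / (2::real)" by (simp add: exp_minus field_simps)
  qed auto
  also have "\<dots> \<le> (1 / 2) ^ 1" using n by (intro power_decreasing) auto
  finally have small: "(\<Sum>Y\<in>{Y\<in>Pow U. card Y < n}. ?P Y) \<le> 1 / 2" by simp
  have "(\<Sum>Y\<in>Pow U. ?P Y) = (\<Sum>Y\<in>{Y\<in>Pow U. card Y < n}. ?P Y) + (\<Sum>Y\<in>{Y\<in>Pow U. n \<le> card Y}. ?P Y)"
    using U by (subst sum.union_disjoint[symmetric]) (auto intro!: sum.cong)
  then have "1 / 2 \<le> (\<Sum>Y\<in>{Y\<in>Pow U. n \<le> card Y}. ?P Y)" using small total1 by simp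
  also have "\<dots> \<le> (\<Sum>Y\<in>{Y\<in>Pow U. n \<le> card Y}. \<Sum>J\<in>{J\<in>F. J \<subseteq> Y}. ?P Y)"
  proof (rule sum_mono)
    fix Y assume Y: "Y \<in> {Y\<in>Pow U. n \<le> card Y}"
    then obtain J where "J \<in> F" "J \<subseteq> Y" using hit by blast
    then have "{J\<in>F. J \<subseteq> Y} \<noteq> {}" by blast
    then have "1 \<le> card {J\<in>F. J \<subseteq> Y}" using finF by (simp add: Suc_le_eq card_gt_0_iff)
    then have "1 * ?P Y \<le> real (card {J\<in>F. J \<subseteq> Y}) * ?P Y"
      using P0[of Y] Y by (intro mult_right_mono) auto
    then show "?P Y \<le> (\<Sum>J\<in>{J\<in>F. J \<subseteq> Y}. ?P Y)" by simp
  qed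
  also have "\<dots> \<le> (\<Sum>Y\<in>Pow U. \<Sum>J\<in>{J\<in>F. J \<subseteq> Y}. ?P Y)"
    using U P0 by (intro sum_mono2 sum_nonneg) auto
  also have "\<dots> = (\<Sum>J\<in>F. \<Sum>Y\<in>{Y\<in>Pow U. J \<subseteq> Y}. ?P Y)"
    using U finF by (intro sum.swap_restrict) auto
  also have "\<dots> = (\<Sum>J\<in>F. prod p J)"
  proof (rule sum.cong[OF refl])
    fix J assume "J \<in> F"
    have "{Y\<in>Pow U. J \<subseteq> Y} = {Y. J \<subseteq> Y \<and> Y \<subseteq> U}" by auto
    then show "(\<Sum>Y\<in>{Y\<in>Pow U. J \<subseteq> Y}. ?P Y) = prod p J"
      using sum_Pow_prod_bernoulli[OF U, of J p] \<open>J \<in> F\<close> F by auto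
  qed
  finally show ?thesis .
qed

text \<open>Rankin's bound: sets of size at most \<open>t\<close> are penalised by \<open>s ^ card J \<ge> s powr t\<close>, where \<open>s = t / X\<close>.\<close>

lemma sum_prod_small_sets_le:
  fixes w :: "'a \<Rightarrow> real"
  assumes U: "finite U" and w: "\<And>u. u \<in> U \<Longrightarrow> 0 \<le> w u"
    and X: "sum w U \<le> X" and t: "0 < t" "t \<le> X"
  shows "(\<Sum>J\<in>{J\<in>Pow U. real (card J) \<le> t}. prod w J) \<le> (exp 1 * X / t) powr t"
proof -
  define s where "s = t / X"
  have s: "0 < s" "s \<le> 1" using t by (auto simp: s_def)
  have "(\<Sum>J\<in>{J\<in>Pow U. real (card J) \<le> t}. prod w J) * s powr t
      = (\<Sum>J\<in>{J\<in>Pow U. real (card J) \<le> t}. prod w J * s powr t)" by (simp add: sum_distrib_right)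
  also have "\<dots> \<le> (\<Sum>J\<in>{J\<in>Pow U. real (card J) \<le> t}. (\<Prod>u\<in>J. s * w u))"
  proof (rule sum_mono)
    fix J assume J: "J \<in> {J\<in>Pow U. real (card J) \<le> t}"
    have "s powr t \<le> s powr real (card J)" using J s by (intro powr_mono') auto
    also have "\<dots> = s ^ card J" using s by (simp add: powr_realpow)
    finally have "prod w J * s powr t \<le> prod w J * s ^ card J"
      using w J by (intro mult_left_mono prod_nonneg) auto
    then show "prod w J * s powr t \<le> (\<Prod>u\<in>J. s * w u)" by (simp add: prod.distrib mult.commute)
  qed
  also have "\<dots> \<le> (\<Sum>J\<in>Pow U. (\<Prod>u\<in>J. s * w u))"
    using U w s by (intro sum_mono2) (auto intro!: prod_nonneg)
  also have "\<dots> = (\<Prod>u\<in>U. s * w u + 1)" using U by (subst prod_add) auto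
  also have "\<dots> \<le> (\<Prod>u\<in>U. exp (s * w u))"
  proof (rule prod_mono)
    fix u assume "u \<in> U"
    then have "0 \<le> s * w u" using w s by simp
    then show "0 \<le> s * w u + 1 \<and> s * w u + 1 \<le> exp (s * w u)"
      using exp_ge_add_one_self[of "s * w u"] by linarith
  qed
  also have "\<dots> = exp (s * sum w U)" using U by (simp add: exp_sum sum_distrib_left)
  also have "\<dots> \<le> exp t"
    using mult_left_mono[OF X, of s] s t by (simp add: s_def)
  finally have "(\<Sum>J\<in>{J\<in>Pow U. real (card J) \<le> t}. prod w J) * s powr t \<le> exp t" .
  then have "(\<Sum>J\<in>{J\<in>Pow U. real (card J) \<le> t}. prod w J) \<le> exp t / s powr t"
    using s by (simp add: field_simps)
  also have "\<dots> = (exp 1 / s) powr t" using s by (simp add: powr_divide exp_powr_real)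
  also have "exp 1 / s = exp 1 * X / t" by (simp add: s_def)
  finally show ?thesis .
qed

text \<open>With \<open>X = sum lam U\<close>, Rankin's bound for the left side is at most
  \<open>Q\<close> as long as \<open>X \<le> 16 * n\<close>. Beyond that it grows at most like
  \<open>(X / (16 * n)) ^ a\<close>, while scaling \<open>lam\<close> down to total weight
  \<open>4 * n\<close> shows that the independent \<open>a\<close>-sets carry weight at least
  \<open>(X / (4 * n)) ^ a / 2\<close>. The quotient of the two cut-offs is the source of
  \<open>4 ^ a\<close>; the 64 in \<open>Q\<close> is 16 times the base 4.\<close>

lemma small_sets_dichotomy:
  fixes lam :: "'a \<Rightarrow> real" and ind :: "'a set \<Rightarrow> bool"
  assumes U: "finite U" and lam: "\<And>u. u \<in> U \<Longrightarrow> 0 \<le> lam u \<and> lam u \<le> 1"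
    and n: "1 \<le> n" and t: "0 < t" "t \<le> real a" "t \<le> 64 * real n"
    and ind: "\<And>Y. Y \<subseteq> U \<Longrightarrow> n \<le> card Y \<Longrightarrow> \<exists>J\<subseteq>Y. card J = a \<and> ind J"
  defines "Q \<equiv> (64 * exp 1 * real n / t) powr t"
  shows "(\<Sum>J\<in>{J\<in>Pow U. ind J \<and> real (card J) \<le> t}. 4 ^ card J * prod lam J)
    \<le> Q + 2 * Q / 4 ^ a * (\<Sum>J\<in>{J\<in>Pow U. ind J \<and> card J = a}. prod lam J)" (is "?T \<le> Q + _ * ?Z")
proof -
  define X where "X = sum lam U"
  have Z0: "0 \<le> ?Z" using lam by (intro sum_nonneg prod_nonneg) auto
  have Q0: "0 \<le> Q" unfolding Q_def by simp
  have "?T \<le> (\<Sum>J\<in>{J\<in>Pow U. real (card J) \<le> t}. 4 ^ card J * prod lam J)"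
    using U lam by (intro sum_mono2) (auto intro!: mult_nonneg_nonneg prod_nonneg)
  also have "\<dots> = (\<Sum>J\<in>{J\<in>Pow U. real (card J) \<le> t}. (\<Prod>u\<in>J. 4 * lam u))"
    by (simp add: prod.distrib)
  finally have T: "?T \<le> (\<Sum>J\<in>{J\<in>Pow U. real (card J) \<le> t}. (\<Prod>u\<in>J. 4 * lam u))" .
  have sum4: "(\<Sum>u\<in>U. 4 * lam u) = 4 * X" by (simp add: X_def sum_distrib_left)
  show ?thesis
  proof (cases "X \<le> 16 * real n")
    case True
    note T
    also have "(\<Sum>J\<in>{J\<in>Pow U. real (card J) \<le> t}. (\<Prod>u\<in>J. 4 * lam u)) \<le> (exp 1 * (64 * real n) / t) powr t"
      using True lam t by (intro sum_prod_small_sets_le[OF U]) (simp_all add: sum4)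
    also have "\<dots> = Q" by (simp add: Q_def mult_ac)
    finally show ?thesis using Q0 Z0 by (simp add: add_increasing2)
  next
    case False
    define p where "p u = lam u * (4 * real n / X)" for u
    have X0: "0 < X" using False n by simp
    have frac: "4 * real n / X \<le> 1" "0 \<le> 4 * real n / X" using False X0 by auto
    note T
    also have "(\<Sum>J\<in>{J\<in>Pow U. real (card J) \<le> t}. (\<Prod>u\<in>J. 4 * lam u)) \<le> (exp 1 * (4 * X) / t) powr t"
      using False lam t by (intro sum_prod_small_sets_le[OF U]) (simp_all add: sum4)
    also have "exp 1 * (4 * X) / t = (64 * exp 1 * real n / t) * (X / (16 * real n))"
      using n t by (simp add: field_simps)
    also have "\<dots> powr t = Q * (X / (16 * real n)) powr t"
      unfolding Q_def by (rule powr_mult)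
    also have "\<dots> \<le> Q * (X / (16 * real n)) powr (real a)"
      using False n t Q0 by (intro mult_left_mono powr_mono) (auto simp: field_simps)
    also have "\<dots> = Q * (X / (16 * real n)) ^ a" using n X0 by (simp add: powr_realpow)
    finally have T2: "?T \<le> Q * (X / (16 * real n)) ^ a" .
    have "1 / 2 \<le> (\<Sum>J\<in>{J\<in>Pow U. ind J \<and> card J = a}. prod p J)"
    proof (rule sum_prod_hitting_family[OF U, where n = n])
      fix u assume "u \<in> U"
      then show "0 \<le> p u \<and> p u \<le> 1"
        using lam[of u] frac mult_le_one[of "lam u" "4 * real n / X"] mult_nonneg_nonneg[of "lam u" "4 * real n / X"]
        unfolding p_def by blast
    next
      show "sum p U = 4 * real n" using X0 unfolding p_def sum_distrib_right[symmetric] X_def[symmetric] by simp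
    next
      fix Y assume "Y \<subseteq> U" "n \<le> card Y"
      from ind[OF this] \<open>Y \<subseteq> U\<close> show "\<exists>J\<in>{J\<in>Pow U. ind J \<and> card J = a}. J \<subseteq> Y" by blast
    qed (use n in auto)
    also have "\<dots> = (4 * real n / X) ^ a * ?Z"
      unfolding sum_distrib_left p_def prod.distrib by (intro sum.cong) (auto simp: mult.commute)
    finally have "1 / 2 \<le> (4 * real n / X) ^ a * ?Z" .
    then have "(X / (4 * real n)) ^ a * (1 / 2) \<le> (X / (4 * real n)) ^ a * ((4 * real n / X) ^ a * ?Z)"
      using X0 by (intro mult_left_mono) auto
    also have "\<dots> = ((X / (4 * real n)) * (4 * real n / X)) ^ a * ?Z"
      by (simp only: power_mult_distrib mult.assoc)
    also have "(X / (4 * real n)) * (4 * real n / X) = 1" using X0 n by simp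
    finally have "(X / (4 * real n)) ^ a \<le> 2 * ?Z" by simp
    moreover have "(X / (16 * real n)) ^ a * 4 ^ a = (X / (4 * real n)) ^ a"
      by (simp add: power_mult_distrib[symmetric])
    ultimately have "(X / (16 * real n)) ^ a * 4 ^ a \<le> 2 * ?Z" by simp
    then have "(X / (16 * real n)) ^ a \<le> 2 * ?Z / 4 ^ a" by (simp add: field_simps)
    then have "Q * (X / (16 * real n)) ^ a \<le> Q * (2 * ?Z / 4 ^ a)" using Q0 by (rule mult_left_mono)
    then show ?thesis using T2 Q0 by (simp add: mult_ac)
  qed
qed

section \<open>Counting colourings from lists\<close>

text \<open>\<open>E\<close> stands for adjacency in the base graph and \<open>X\<close> for
  adjacency in the cover graph. \<open>X_matching\<close> is what lets a coloured vertex block at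
  most one colour of any other list.\<close>

locale conflict_system =
  fixes V :: "'a set" and E :: "'a \<Rightarrow> 'a \<Rightarrow> bool"
    and L :: "'a \<Rightarrow> 'c set" and X :: "'c \<Rightarrow> 'c \<Rightarrow> bool"
  assumes finite_V: "finite V"
    and finite_L: "v \<in> V \<Longrightarrow> finite (L v)"
    and E_irrefl: "\<not> E v v"
    and X_sym: "X x y \<Longrightarrow> X y x"
    and X_adj: "\<lbrakk>u \<in> V; w \<in> V; x \<in> L u; y \<in> L w; X x y\<rbrakk> \<Longrightarrow> E u w"
    and X_matching: "\<lbrakk>u \<in> V; w \<in> V; x \<in> L u; y \<in> L w; y' \<in> L w; X x y; X x y'\<rbrakk> \<Longrightarrow> y = y'"
begin

text \<open>The lists \<open>B\<close> are a parameter because recolourings of a small set are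
  counted as colourings from shortened lists.\<close>

definition colourings :: "('a \<Rightarrow> 'c set) \<Rightarrow> 'a set \<Rightarrow> ('a \<Rightarrow> 'c) set" where
  "colourings B S = {\<sigma> \<in> Pi\<^sub>E S B. \<forall>u\<in>S. \<forall>w\<in>S. \<not> X (\<sigma> u) (\<sigma> w)}"

text \<open>For \<open>u\<close> in \<open>S\<close> the colour of \<open>u\<close> itself blocks
  nothing in \<open>L u\<close>, as \<open>E\<close> is irreflexive. So these are the colours that
  \<open>u\<close> can take while all others stay fixed, including its present one.\<close>

definition avail :: "('a \<Rightarrow> 'c set) \<Rightarrow> 'a set \<Rightarrow> ('a \<Rightarrow> 'c) \<Rightarrow> 'a \<Rightarrow> 'c set" where
  "avail B S \<sigma> u = {x \<in> B u. \<forall>w\<in>S. \<not> X x (\<sigma> w)}"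

definition occ :: "'a set \<Rightarrow> 'c \<Rightarrow> ('a \<Rightarrow> 'c) \<Rightarrow> 'a set" where
  "occ S c \<sigma> = {u \<in> S. X c (\<sigma> u)}"

definition mate :: "'c \<Rightarrow> 'a \<Rightarrow> 'c" where
  "mate c u = (THE x. x \<in> L u \<and> X c x)"

text \<open>The ground set of the hard-core model: vertices that can switch to the colour
  conflicting with \<open>c\<close> and have so many alternatives that their fugacity hardly changes
  when a few other vertices are recoloured.\<close>

definition rich :: "real \<Rightarrow> 'a set \<Rightarrow> 'c \<Rightarrow> ('a \<Rightarrow> 'c) \<Rightarrow> 'a set" where
  "rich g S c \<sigma> = {u \<in> S. (\<exists>x\<in>avail L S \<sigma> u. X c x) \<and> g \<le> card (avail L S \<sigma> u)}"

text \<open>For vertices that have mates this is implied by independence in the base graph, and it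
  is exactly what allows all of \<open>J\<close> to switch to the mates of \<open>c\<close>
  simultaneously.\<close>

definition ind :: "'c \<Rightarrow> 'a set \<Rightarrow> bool" where
  "ind c J \<longleftrightarrow> (\<forall>u\<in>J. \<forall>w\<in>J. \<not> X (mate c u) (mate c w))"

section \<open>Elementary counts of colourings and available colours\<close>

lemma mate_eq:
  "\<lbrakk>v \<in> V; c \<in> L v; u \<in> V; x \<in> L u; X c x\<rbrakk> \<Longrightarrow> mate c u = x"
  unfolding mate_def using X_matching by (intro the_equality) blast+

lemma finite_colourings:
  assumes "finite S" "\<And>u. u \<in> S \<Longrightarrow> finite (B u)"
  shows "finite (colourings B S)"
proof (rule finite_subset)
  show "finite (Pi\<^sub>E S B)" using assms by (rule finite_PiE)
qed (auto simp: colourings_def)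

lemma finite_avail: "u \<in> V \<Longrightarrow> finite (avail L S \<sigma> u)"
  unfolding avail_def using finite_L by auto

lemma colourings_in: "\<sigma> \<in> colourings B S \<Longrightarrow> u \<in> S \<Longrightarrow> \<sigma> u \<in> B u"
  by (auto simp: colourings_def)

lemma colourings_no_conflict: "\<sigma> \<in> colourings B S \<Longrightarrow> u \<in> S \<Longrightarrow> w \<in> S \<Longrightarrow> \<not> X (\<sigma> u) (\<sigma> w)"
  by (auto simp: colourings_def)

lemma card_conflicting_le_1:
  assumes "u \<in> V" "w \<in> V" "y \<in> L w" "B \<subseteq> L u"
  shows "card {x \<in> B. X x y} \<le> 1"
proof -
  have "\<forall>x\<in>{x \<in> B. X x y}. \<forall>x'\<in>{x \<in> B. X x y}. x = x'"
    using assms X_matching[of w u y] X_sym by blast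
  moreover have "finite {x \<in> B. X x y}"
    using assms finite_L[of u] by (auto intro: finite_subset)
  ultimately show ?thesis by (simp add: card_le_Suc0_iff_eq)
qed

text \<open>By the matching property each new colour on \<open>J\<close> blocks at most one colour
  of \<open>u\<close>, so a change on \<open>J\<close> costs at most \<open>card J\<close> of
  them.\<close>

lemma card_avail_change:
  assumes J: "finite J" "J \<subseteq> V" and u: "u \<in> V" "B u \<subseteq> L u"
    and eq: "\<And>w. w \<in> S - J \<Longrightarrow> \<sigma> w = \<sigma>' w" and \<sigma>': "\<And>w. w \<in> J \<Longrightarrow> \<sigma>' w \<in> L w"
  shows "card (avail B S \<sigma> u) \<le> card (avail B S \<sigma>' u) + card J"
proof -
  let ?K = "\<lambda>w. {x \<in> B u. X x (\<sigma>' w)}"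
  have fin: "finite (B u)" using u finite_L finite_subset by blast
  have "avail B S \<sigma> u \<subseteq> avail B S \<sigma>' u \<union> (\<Union>w\<in>J. ?K w)"
    using eq by (fastforce simp: avail_def)
  then have "card (avail B S \<sigma> u) \<le> card (avail B S \<sigma>' u \<union> (\<Union>w\<in>J. ?K w))"
    using fin J by (intro card_mono) (auto simp: avail_def)
  also have "\<dots> \<le> card (avail B S \<sigma>' u) + card (\<Union>w\<in>J. ?K w)" by (rule card_Un_le)
  also have "card (\<Union>w\<in>J. ?K w) \<le> (\<Sum>w\<in>J. card (?K w))" using J by (intro card_UN_le) auto
  also have "\<dots> \<le> (\<Sum>w\<in>J. 1)"
  proof (rule sum_mono)
    fix w assume "w \<in> J"
    then show "card (?K w) \<le> 1" using u J \<sigma>' by (intro card_conflicting_le_1[of u w]) auto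
  qed
  finally show ?thesis by simp
qed

lemma card_colourings_insert:
  assumes S: "insert v S \<subseteq> V" "v \<notin> S" and B: "\<And>u. u \<in> insert v S \<Longrightarrow> B u \<subseteq> L u"
  shows "card (colourings B (insert v S)) = (\<Sum>\<sigma>\<in>colourings B S. card (avail B S \<sigma> v))"
proof -
  have fin: "finite S" using S finite_V by (auto dest: finite_subset)
  have finB: "finite (B u)" if "u \<in> insert v S" for u
    using finite_subset[OF B[OF that] finite_L] S that by auto
  have "(\<Sum>\<sigma>\<in>colourings B S. card (avail B S \<sigma> v)) = card (Sigma (colourings B S) (\<lambda>\<sigma>. avail B S \<sigma> v))"
    using fin finB by (intro card_SigmaI[symmetric] finite_colourings) (auto simp: avail_def)
  also have "\<dots> = card (colourings B (insert v S))"
  proof (rule bij_betw_same_card, rule bij_betwI)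
    show "(\<lambda>(\<sigma>, x). \<sigma>(v := x)) \<in> Sigma (colourings B S) (\<lambda>\<sigma>. avail B S \<sigma> v) \<rightarrow> colourings B (insert v S)"
    proof clarsimp
      fix \<sigma> x assume s: "\<sigma> \<in> colourings B S" and x: "x \<in> avail B S \<sigma> v"
      have "\<not> X x x" using x S B E_irrefl X_adj[of v v x x] by (auto simp: avail_def)
      then show "\<sigma>(v := x) \<in> colourings B (insert v S)"
        using s x S(2) X_sym by (fastforce simp: colourings_def avail_def PiE_def extensional_def)
    qed
    show "(\<lambda>\<tau>. (restrict \<tau> S, \<tau> v)) \<in> colourings B (insert v S) \<rightarrow> Sigma (colourings B S) (\<lambda>\<sigma>. avail B S \<sigma> v)"
      by (auto simp: colourings_def avail_def)
    show "(\<lambda>\<tau>. (restrict \<tau> S, \<tau> v)) ((\<lambda>(\<sigma>, x). \<sigma>(v := x)) p) = p"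
      if "p \<in> Sigma (colourings B S) (\<lambda>\<sigma>. avail B S \<sigma> v)" for p
      using that S(2) by (auto simp: colourings_def restrict_def PiE_def extensional_def fun_eq_iff)
    show "(\<lambda>(\<sigma>, x). \<sigma>(v := x)) ((\<lambda>\<tau>. (restrict \<tau> S, \<tau> v)) \<tau>) = \<tau>"
      if "\<tau> \<in> colourings B (insert v S)" for \<tau>
      using that by (auto simp: colourings_def restrict_def PiE_def extensional_def fun_eq_iff)
  qed
  finally show ?thesis by simp
qed

text \<open>Colour \<open>J\<close> vertex by vertex: each vertex already coloured blocks at most
  one colour of the next list, hence fewer than \<open>j\<close> in total.\<close>

lemma card_colourings_greedy:
  assumes J: "finite J" "J \<subseteq> V" and B: "\<And>u. u \<in> J \<Longrightarrow> B u \<subseteq> L u"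
    and big: "\<And>u. u \<in> J \<Longrightarrow> real j \<le> real (card (B u))" and j: "card J \<le> j"
  shows "(\<Prod>u\<in>J. real (card (B u)) - real j) \<le> real (card (colourings B J))"
  using assms
proof (induction J rule: finite_induct)
  case empty
  then show ?case by (simp add: colourings_def)
next
  case (insert u K)
  have IH: "(\<Prod>u\<in>K. real (card (B u)) - real j) \<le> real (card (colourings B K))"
    using insert by auto
  have "real (card (colourings B K)) * (real (card (B u)) - real j)
      = (\<Sum>\<sigma>\<in>colourings B K. real (card (B u)) - real j)" by simp
  also have "\<dots> \<le> (\<Sum>\<sigma>\<in>colourings B K. real (card (avail B K \<sigma> u)))"
  proof (rule sum_mono)
    fix \<sigma> assume s: "\<sigma> \<in> colourings B K"
    let ?K = "\<lambda>w. {x \<in> B u. X x (\<sigma> w)}"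
    have uV: "u \<in> V" "B u \<subseteq> L u" using insert.prems by auto
    have fin: "finite (B u)" using finite_subset[OF uV(2) finite_L[OF uV(1)]] .
    have "B u \<subseteq> avail B K \<sigma> u \<union> (\<Union>w\<in>K. ?K w)" by (auto simp: avail_def)
    then have "card (B u) \<le> card (avail B K \<sigma> u \<union> (\<Union>w\<in>K. ?K w))"
      using fin insert.hyps by (intro card_mono) (auto simp: avail_def)
    also have "\<dots> \<le> card (avail B K \<sigma> u) + card (\<Union>w\<in>K. ?K w)" by (rule card_Un_le)
    also have "card (\<Union>w\<in>K. ?K w) \<le> (\<Sum>w\<in>K. card (?K w))" using insert.hyps by (intro card_UN_le) auto
    also have "\<dots> \<le> (\<Sum>w\<in>K. 1)"
    proof (rule sum_mono)
      fix w assume "w \<in> K"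
      then show "card (?K w) \<le> 1"
        using uV insert.prems colourings_in[OF s, of w] by (intro card_conflicting_le_1[of u w]) auto
    qed
    finally show "real (card (B u)) - real j \<le> real (card (avail B K \<sigma> u))"
      using insert.prems insert.hyps by simp
  qed
  also have "\<dots> = real (card (colourings B (insert u K)))"
    using insert by (subst card_colourings_insert) auto
  finally have "real (card (colourings B K)) * (real (card (B u)) - real j)
    \<le> real (card (colourings B (insert u K)))" .
  moreover have "(\<Prod>u\<in>K. real (card (B u)) - real j) * (real (card (B u)) - real j)
      \<le> real (card (colourings B K)) * (real (card (B u)) - real j)"
    using IH insert.prems(3)[of u] by (intro mult_right_mono) auto
  ultimately show ?case using insert.hyps by (simp add: mult.commute)
qed

text \<open>The available set at \<open>u\<close> does not depend on the colour of \<open>u\<close>,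
  so each colouring of \<open>S - {u}\<close> extends to fewer than \<open>\<theta>\<close> of the
  colourings counted here.\<close>

lemma card_few_available_le:
  assumes S: "S \<subseteq> V" "u \<in> S" and \<theta>: "0 \<le> \<theta>"
  shows "real (card {\<sigma> \<in> colourings L S. real (card (avail L S \<sigma> u)) < \<theta>})
    \<le> \<theta> * real (card (colourings L (S - {u})))"
proof -
  let ?S = "S - {u}"
  let ?D = "{\<sigma> \<in> colourings L S. real (card (avail L S \<sigma> u)) < \<theta>}"
  let ?R = "{\<tau> \<in> colourings L ?S. real (card (avail L ?S \<tau> u)) < \<theta>}"
  have fin: "finite (colourings L ?S)"
    using S finite_V finite_L by (intro finite_colourings) (auto intro: finite_subset)
  have finA: "finite (avail L ?S \<tau> u)" for \<tau> using S by (intro finite_avail) auto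
  have eq: "avail L S \<sigma> u = avail L ?S (restrict \<sigma> ?S) u" if "\<sigma> \<in> colourings L S" for \<sigma>
  proof -
    have "\<not> X x (\<sigma> u)" if "x \<in> L u" for x
      using that S E_irrefl X_adj[of u u x "\<sigma> u"] colourings_in[OF \<open>\<sigma> \<in> colourings L S\<close>, of u] by auto
    then show ?thesis by (auto simp: avail_def)
  qed
  have "card ?D \<le> card (Sigma ?R (\<lambda>\<tau>. avail L ?S \<tau> u))"
  proof (rule card_inj_on_le[where f = "\<lambda>\<sigma>. (restrict \<sigma> ?S, \<sigma> u)"])
    show "inj_on (\<lambda>\<sigma>. (restrict \<sigma> ?S, \<sigma> u)) ?D"
    proof (rule inj_onI)
      fix \<sigma> \<sigma>' assume a: "\<sigma> \<in> ?D" "\<sigma>' \<in> ?D" "(restrict \<sigma> ?S, \<sigma> u) = (restrict \<sigma>' ?S, \<sigma>' u)"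
      show "\<sigma> = \<sigma>'"
      proof (rule PiE_ext[of \<sigma> S L \<sigma>'])
        show "\<sigma> \<in> Pi\<^sub>E S L" "\<sigma>' \<in> Pi\<^sub>E S L" using a by (auto simp: colourings_def)
        fix w assume "w \<in> S"
        then show "\<sigma> w = \<sigma>' w" using a(3) by (cases "w = u") (auto simp: restrict_def fun_eq_iff dest: spec[of _ w])
      qed
    qed
    show "(\<lambda>\<sigma>. (restrict \<sigma> ?S, \<sigma> u)) ` ?D \<subseteq> Sigma ?R (\<lambda>\<tau>. avail L ?S \<tau> u)"
    proof (rule image_subsetI)
      fix \<sigma> assume a: "\<sigma> \<in> ?D"
      then have "restrict \<sigma> ?S \<in> colourings L ?S" by (auto simp: colourings_def)
      moreover have "\<sigma> u \<in> avail L S \<sigma> u" using a S by (auto simp: avail_def colourings_def)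
      ultimately show "(restrict \<sigma> ?S, \<sigma> u) \<in> Sigma ?R (\<lambda>\<tau>. avail L ?S \<tau> u)"
        using a eq[of \<sigma>] by auto
    qed
    show "finite (Sigma ?R (\<lambda>\<tau>. avail L ?S \<tau> u))" using fin finA by (intro finite_SigmaI) auto
  qed
  also have "\<dots> = (\<Sum>\<tau>\<in>?R. card (avail L ?S \<tau> u))"
    using fin finA by (intro card_SigmaI) auto
  finally have "real (card ?D) \<le> real (\<Sum>\<tau>\<in>?R. card (avail L ?S \<tau> u))" by (simp only: of_nat_le_iff)
  also have "\<dots> = (\<Sum>\<tau>\<in>?R. real (card (avail L ?S \<tau> u)))" by simp
  also have "\<dots> \<le> (\<Sum>\<tau>\<in>?R. \<theta>)" by (intro sum_mono) auto
  also have "\<dots> = \<theta> * real (card ?R)" by simp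
  also have "\<dots> \<le> \<theta> * real (card (colourings L ?S))"
    using fin \<theta> by (intro mult_left_mono) (auto intro: card_mono)
  finally show ?thesis .
qed

section \<open>Recolouring the vertices that block a colour\<close>

definition empty_colourings :: "'a set \<Rightarrow> 'c \<Rightarrow> ('a \<Rightarrow> 'c) set" where
  "empty_colourings S c = {\<sigma> \<in> colourings L S. occ S c \<sigma> = {}}"

lemma finite_colourings_L: "S \<subseteq> V \<Longrightarrow> finite (colourings L S)"
  using finite_V finite_L by (intro finite_colourings) (auto dest: finite_subset)

text \<open>Recolouring the set \<open>J\<close> of neighbours that block \<open>c\<close>: the new colours avoid those blocked by
  the old colouring, so the mates of \<open>c\<close> stay available on \<open>J\<close>.\<close>

lemma recolour_occ:
  assumes v: "v \<in> V" "c \<in> L v" and S: "S \<subseteq> V" and J: "J \<subseteq> S"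
    and \<sigma>: "\<sigma> \<in> colourings L S" "occ S c \<sigma> = J"
    and f: "f \<in> colourings (\<lambda>u. avail L S \<sigma> u - {\<sigma> u}) J"
  defines "\<tau> \<equiv> override_on \<sigma> f J"
  shows "\<tau> \<in> empty_colourings S c" and "ind c J"
    and "u \<in> J \<Longrightarrow> \<sigma> u \<in> avail L S \<tau> u"
    and "u \<in> J \<Longrightarrow> X c (\<sigma> u) \<and> mate c u = \<sigma> u"
    and "u \<in> S \<Longrightarrow> card (avail L S \<tau> u) \<le> card (avail L S \<sigma> u) + card J"
    and "u \<in> S \<Longrightarrow> card (avail L S \<sigma> u) \<le> card (avail L S \<tau> u) + card J"
proof -
  have fin: "finite J" "J \<subseteq> V" using J S finite_V by (auto dest: finite_subset)
  have XJ: "X c (\<sigma> u) \<longleftrightarrow> u \<in> J" if "u \<in> S" for u using \<sigma>(2) that by (auto simp: occ_def)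
  have \<sigma>L: "\<sigma> u \<in> L u" if "u \<in> S" for u using colourings_in[OF \<sigma>(1) that] .
  have fa: "f u \<in> L u" "f u \<noteq> \<sigma> u" "\<And>w. w \<in> S \<Longrightarrow> \<not> X (f u) (\<sigma> w)" if "u \<in> J" for u
    using colourings_in[OF f that] by (auto simp: avail_def)
  have \<tau>J: "\<tau> u = f u" if "u \<in> J" for u using that by (simp add: \<tau>_def override_on_def)
  have \<tau>nJ: "\<tau> u = \<sigma> u" if "u \<notin> J" for u using that by (simp add: \<tau>_def override_on_def)
  have \<tau>L: "\<tau> u \<in> L u" if "u \<in> S" for u
    using that fa \<sigma>L by (cases "u \<in> J") (auto simp: \<tau>J \<tau>nJ)
  have m: "mate c u = \<sigma> u" if "u \<in> J" for u
    using that J S v XJ[of u] \<sigma>L[of u] by (intro mate_eq[of v]) auto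
  then show "u \<in> J \<Longrightarrow> X c (\<sigma> u) \<and> mate c u = \<sigma> u" using XJ J by blast
  have nc: "\<not> X (\<tau> u) (\<tau> w)" if "u \<in> S" "w \<in> S" for u w
    using that colourings_no_conflict[OF f, of u w] colourings_no_conflict[OF \<sigma>(1), of u w]
      fa(3)[of u w] fa(3)[of w u] X_sym[of "\<sigma> u" "f w"]
    by (cases "u \<in> J"; cases "w \<in> J") (auto simp: \<tau>J \<tau>nJ)
  have "\<tau> \<in> Pi\<^sub>E S L"
  proof (rule PiE_I)
    fix u assume "u \<notin> S"
    then show "\<tau> u = undefined" using J \<sigma>(1) by (subst \<tau>nJ) (auto simp: colourings_def)
  qed (rule \<tau>L)
  then have \<tau>col: "\<tau> \<in> colourings L S" using nc by (auto simp: colourings_def)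
  moreover have "occ S c \<tau> = {}"
  proof -
    have "\<not> X c (\<tau> u)" if u: "u \<in> S" for u
    proof (cases "u \<in> J")
      case True
      show ?thesis
      proof
        assume "X c (\<tau> u)"
        \<comment> \<open>The reason for removing \<open>\<sigma> u\<close> from the list: the only
          colour of \<open>u\<close> that conflicts with \<open>c\<close> is the old one.\<close>
        then have "mate c u = f u"
          using True fa[of u] u S v by (intro mate_eq[of v]) (auto simp: \<tau>J)
        then show False using m[OF True] fa(2)[OF True] by simp
      qed
    next
      case False
      then show ?thesis using XJ[OF u] by (simp add: \<tau>nJ)
    qed
    then show ?thesis by (auto simp: occ_def)
  qed
  ultimately show "\<tau> \<in> empty_colourings S c" by (simp add: empty_colourings_def)
  show "ind c J"
    unfolding ind_def using m colourings_no_conflict[OF \<sigma>(1)] J by auto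
  show "u \<in> J \<Longrightarrow> \<sigma> u \<in> avail L S \<tau> u"
  proof -
    assume u: "u \<in> J"
    have "\<not> X (\<sigma> u) (\<tau> w)" if "w \<in> S" for w
      using that u J colourings_no_conflict[OF \<sigma>(1), of u w] fa(3)[of w u] X_sym[of "\<sigma> u" "f w"]
      by (cases "w \<in> J") (auto simp: \<tau>J \<tau>nJ)
    then show ?thesis using u J \<sigma>L by (auto simp: avail_def)
  qed
  show "u \<in> S \<Longrightarrow> card (avail L S \<tau> u) \<le> card (avail L S \<sigma> u) + card J"
    using fin S J \<sigma>L \<tau>nJ by (intro card_avail_change) auto
  show "u \<in> S \<Longrightarrow> card (avail L S \<sigma> u) \<le> card (avail L S \<tau> u) + card J"
    using fin S J \<tau>L \<tau>nJ by (intro card_avail_change) auto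
qed

text \<open>Charge \<open>\<sigma>\<close> to all its recolourings on \<open>J\<close>. If
  \<open>u\<close> has \<open>n u\<close> available colours, there are at least the product of
  \<open>n u - 1 - card J\<close> of them, each of weight at least the product of
  \<open>2 / (n u + card J)\<close>; as \<open>n u \<ge> 3 * card J + 2\<close>, the total charge is
  at least 1. A recolouring determines \<open>\<sigma>\<close>, which agrees with it outside
  \<open>J\<close> and equals the mate of \<open>c\<close> on \<open>J\<close>.\<close>

lemma card_occ_eq_le:
  assumes v: "v \<in> V" "c \<in> L v" and S: "S \<subseteq> V" and J: "J \<subseteq> S"
    and g: "2 * real (card J) + 2 \<le> g" and h: "g + real (card J) \<le> h"
  shows "real (card {\<sigma> \<in> colourings L S. occ S c \<sigma> = J \<and> (\<forall>u\<in>J. h \<le> real (card (avail L S \<sigma> u)))})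
    \<le> (\<Sum>\<tau>\<in>{\<tau> \<in> empty_colourings S c. J \<subseteq> rich g S c \<tau> \<and> ind c J}. \<Prod>u\<in>J. 2 / real (card (avail L S \<tau> u)))"
proof -
  let ?D = "{\<sigma> \<in> colourings L S. occ S c \<sigma> = J \<and> (\<forall>u\<in>J. h \<le> real (card (avail L S \<sigma> u)))}"
  let ?T = "{\<tau> \<in> empty_colourings S c. J \<subseteq> rich g S c \<tau> \<and> ind c J}"
  let ?B = "\<lambda>\<sigma> u. avail L S \<sigma> u - {\<sigma> u}"
  let ?w = "\<lambda>\<tau>. \<Prod>u\<in>J. 2 / real (card (avail L S \<tau> u))"
  have fin: "finite J" "J \<subseteq> V" using J S finite_V by (auto dest: finite_subset)
  have finc: "finite (colourings L S)" using S by (rule finite_colourings_L)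
  have finB: "finite (colourings (?B \<sigma>) J)" for \<sigma>
    using fin finite_avail by (intro finite_colourings) auto
  have key: "1 \<le> (\<Sum>f\<in>colourings (?B \<sigma>) J. ?w (override_on \<sigma> f J))" if \<sigma>: "\<sigma> \<in> ?D" for \<sigma>
  proof -
    define n where "n u = real (card (avail L S \<sigma> u))" for u
    have nu: "3 * real (card J) + 2 \<le> n u" if "u \<in> J" for u
      using \<sigma> that g h unfolding n_def by fastforce
    have cardB: "real (card (?B \<sigma> u)) = n u - 1" if "u \<in> J" for u
    proof -
      have "\<sigma> u \<in> avail L S \<sigma> u"
        using \<sigma> that J colourings_in[of \<sigma> L S u] colourings_no_conflict[of \<sigma> L S u] by (auto simp: avail_def)
      moreover have "finite (avail L S \<sigma> u)" using that fin by (intro finite_avail) auto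
      ultimately show ?thesis using nu[OF that] unfolding n_def by (simp add: card_Diff_singleton of_nat_diff)
    qed
    have "(\<Prod>u\<in>J. n u - 1 - real (card J)) = (\<Prod>u\<in>J. real (card (?B \<sigma> u)) - real (card J))"
      using cardB by (intro prod.cong) auto
    also have "\<dots> \<le> real (card (colourings (?B \<sigma>) J))"
      using fin nu cardB by (intro card_colourings_greedy) (auto simp: avail_def, fastforce)
    finally have many: "(\<Prod>u\<in>J. n u - 1 - real (card J)) \<le> real (card (colourings (?B \<sigma>) J))" .
    have "1 = (\<Prod>u\<in>J. 1::real)" by simp
    also have "\<dots> \<le> (\<Prod>u\<in>J. (n u - 1 - real (card J)) * (2 / (n u + real (card J))))"
    proof (rule prod_mono)
      fix u assume "u \<in> J"
      then show "0 \<le> (1::real) \<and> 1 \<le> (n u - 1 - real (card J)) * (2 / (n u + real (card J)))"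
        using nu[of u] by (auto simp: field_simps)
    qed
    also have "\<dots> = (\<Prod>u\<in>J. n u - 1 - real (card J)) * (\<Prod>u\<in>J. 2 / (n u + real (card J)))"
      by (rule prod.distrib)
    also have "\<dots> \<le> real (card (colourings (?B \<sigma>) J)) * (\<Prod>u\<in>J. 2 / (n u + real (card J)))"
      using many nu by (intro mult_right_mono prod_nonneg) force+
    also have "\<dots> = (\<Sum>f\<in>colourings (?B \<sigma>) J. \<Prod>u\<in>J. 2 / (n u + real (card J)))" by simp
    also have "\<dots> \<le> (\<Sum>f\<in>colourings (?B \<sigma>) J. ?w (override_on \<sigma> f J))"
    proof (rule sum_mono, rule prod_mono)
      fix f u assume f: "f \<in> colourings (?B \<sigma>) J" and u: "u \<in> J"
      note rec = recolour_occ[OF v S J _ _ f]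
      have a: "card (avail L S (override_on \<sigma> f J) u) \<le> card (avail L S \<sigma> u) + card J"
        using \<sigma> u J by (intro rec(5)) auto
      have b: "card (avail L S \<sigma> u) \<le> card (avail L S (override_on \<sigma> f J) u) + card J"
        using \<sigma> u J by (intro rec(6)) auto
      have "0 < real (card (avail L S (override_on \<sigma> f J) u))"
        using b nu[OF u] unfolding n_def by linarith
      then show "0 \<le> 2 / (n u + real (card J)) \<and>
          2 / (n u + real (card J)) \<le> 2 / real (card (avail L S (override_on \<sigma> f J) u))"
        using a nu[OF u] unfolding n_def by (auto intro!: divide_left_mono)
    qed
    finally show ?thesis .
  qed
  have inj: "inj_on (\<lambda>(\<sigma>, f). override_on \<sigma> f J) (Sigma ?D (\<lambda>\<sigma>. colourings (?B \<sigma>) J))"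
  proof (rule inj_onI, clarify)
    fix \<sigma> f \<sigma>' f'
    assume s: "\<sigma> \<in> colourings L S" "\<sigma>' \<in> colourings L S"
      and f: "f \<in> colourings (?B \<sigma>) (occ S c \<sigma>)" "f' \<in> colourings (?B \<sigma>') (occ S c \<sigma>)"
      and J': "J = occ S c \<sigma>" and o: "occ S c \<sigma>' = occ S c \<sigma>"
      and eq: "override_on \<sigma> f (occ S c \<sigma>) = override_on \<sigma>' f' (occ S c \<sigma>)"
    have ff: "f u = f' u" if "u \<in> J" for u using fun_cong[OF eq, of u] that J' by simp
    have "f = f'"
      using f ff J' by (intro PiE_ext[of f J]) (auto simp: colourings_def)
    moreover have "\<sigma> = \<sigma>'"
    proof (rule PiE_ext[of \<sigma> S L])
      fix u assume "u \<in> S"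
      show "\<sigma> u = \<sigma>' u"
      proof (cases "u \<in> J")
        case True
        then have "mate c u = \<sigma> u" "mate c u = \<sigma>' u"
          using o J' S s \<open>u \<in> S\<close> v by (auto intro!: mate_eq[of v] simp: occ_def dest: colourings_in)
        then show ?thesis by simp
      next
        case False
        then show ?thesis using fun_cong[OF eq, of u] J' by simp
      qed
    qed (use s in \<open>auto simp: colourings_def\<close>)
    ultimately show "\<sigma> = \<sigma>' \<and> f = f'" by simp
  qed
  have "real (card ?D) = (\<Sum>\<sigma>\<in>?D. 1)" by simp
  also have "\<dots> \<le> (\<Sum>\<sigma>\<in>?D. \<Sum>f\<in>colourings (?B \<sigma>) J. ?w (override_on \<sigma> f J))"
    using key by (rule sum_mono)
  also have "\<dots> = (\<Sum>p\<in>Sigma ?D (\<lambda>\<sigma>. colourings (?B \<sigma>) J). ?w ((\<lambda>(\<sigma>, f). override_on \<sigma> f J) p))"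
    using finc finB by (subst sum.Sigma) (auto simp: case_prod_beta')
  also have "\<dots> = (\<Sum>\<tau>\<in>(\<lambda>(\<sigma>, f). override_on \<sigma> f J) ` Sigma ?D (\<lambda>\<sigma>. colourings (?B \<sigma>) J). ?w \<tau>)"
    using inj by (simp add: sum.reindex)
  also have "\<dots> \<le> (\<Sum>\<tau>\<in>?T. ?w \<tau>)"
  proof (rule sum_mono2)
    show "finite ?T" using finc by (auto simp: empty_colourings_def)
    show "(\<lambda>(\<sigma>, f). override_on \<sigma> f J) ` Sigma ?D (\<lambda>\<sigma>. colourings (?B \<sigma>) J) \<subseteq> ?T"
    proof clarify
      fix \<sigma> f
      assume s: "\<sigma> \<in> colourings L S" and J': "J = occ S c \<sigma>"
        and hh: "\<forall>u\<in>occ S c \<sigma>. h \<le> real (card (avail L S \<sigma> u))"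
        and f: "f \<in> colourings (?B \<sigma>) (occ S c \<sigma>)"
      note rec = recolour_occ[OF v S J s J'[symmetric], of f, folded J', OF f[folded J']]
      have "u \<in> rich g S c (override_on \<sigma> f J)" if u: "u \<in> J" for u
      proof -
        have "real (card (avail L S \<sigma> u)) \<le> real (card (avail L S (override_on \<sigma> f J) u)) + real (card J)"
          using rec(6)[of u] u J by (auto simp flip: of_nat_add)
        moreover have "h \<le> real (card (avail L S \<sigma> u))" using hh u J' by simp
        ultimately have "g \<le> real (card (avail L S (override_on \<sigma> f J) u))" using h by linarith
        then show ?thesis using rec(3)[OF u] rec(4)[OF u] u J by (auto simp: rich_def)
      qed
      then show "override_on \<sigma> f (occ S c \<sigma>) \<in> empty_colourings S c \<and>
          occ S c \<sigma> \<subseteq> rich g S c (override_on \<sigma> f (occ S c \<sigma>)) \<and> ind c (occ S c \<sigma>)"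
        using rec(1,2) J' by auto
    qed
  qed (auto intro: prod_nonneg)
  finally show ?thesis .
qed

text \<open>The opposite recolouring: each \<open>u\<close> in \<open>J\<close> receives its mate of
  \<open>c\<close>, and the old colours on \<open>J\<close> are remembered. They stay available
  under the new \<open>\<sigma>\<close>, so \<open>\<sigma>\<close> arises at most as often as the
  product of its numbers of available colours on \<open>J\<close>. These are at most twice those
  under \<open>\<tau>\<close>, because \<open>card J \<le> g\<close>.\<close>

lemma card_occ_eq_ge:
  assumes v: "v \<in> V" "c \<in> L v" and S: "S \<subseteq> V" and J: "J \<subseteq> S"
    and g: "real (card J) \<le> g"
  shows "(\<Sum>\<tau>\<in>{\<tau> \<in> empty_colourings S c. J \<subseteq> rich g S c \<tau> \<and> ind c J}. \<Prod>u\<in>J. 1 / (2 * real (card (avail L S \<tau> u))))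
    \<le> real (card {\<sigma> \<in> colourings L S. occ S c \<sigma> = J})"
proof -
  let ?D = "{\<sigma> \<in> colourings L S. occ S c \<sigma> = J}"
  let ?T = "{\<tau> \<in> empty_colourings S c. J \<subseteq> rich g S c \<tau> \<and> ind c J}"
  let ?P = "\<lambda>\<sigma>. Pi\<^sub>E J (avail L S \<sigma>)"
  let ?h = "\<lambda>\<tau>. (override_on \<tau> (mate c) J, restrict \<tau> J)"
  let ?w = "\<lambda>\<sigma>. \<Prod>u\<in>J. 1 / real (card (avail L S \<sigma> u))"
  have fin: "finite J" "J \<subseteq> V" using J S finite_V by (auto dest: finite_subset)
  have finc: "finite (colourings L S)" using S by (rule finite_colourings_L)
  have finP: "finite (?P \<sigma>)" for \<sigma>
    using fin finite_avail by (intro finite_PiE) auto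
  have mem: "?h \<tau> \<in> Sigma ?D ?P" and wt: "(\<Prod>u\<in>J. 1 / (2 * real (card (avail L S \<tau> u)))) \<le> ?w (fst (?h \<tau>))"
    if \<tau>: "\<tau> \<in> ?T" for \<tau>
  proof -
    define \<sigma> where "\<sigma> = override_on \<tau> (mate c) J"
    have \<sigma>J: "\<sigma> u = mate c u" if "u \<in> J" for u using that by (simp add: \<sigma>_def)
    have \<sigma>nJ: "\<sigma> u = \<tau> u" if "u \<notin> J" for u using that by (simp add: \<sigma>_def)
    have col: "\<tau> \<in> colourings L S" and emp: "\<And>u. u \<in> S \<Longrightarrow> \<not> X c (\<tau> u)"
      using \<tau> by (auto simp: empty_colourings_def occ_def)
    have \<tau>L: "\<tau> u \<in> L u" if "u \<in> S" for u using colourings_in[OF col that] .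
    have m: "mate c u \<in> L u" "X c (mate c u)" "\<And>w. w \<in> S \<Longrightarrow> \<not> X (mate c u) (\<tau> w)"
        "g \<le> real (card (avail L S \<tau> u))" if "u \<in> J" for u
    proof -
      have "u \<in> rich g S c \<tau>" using \<tau> that by auto
      then obtain x where x: "x \<in> avail L S \<tau> u" "X c x" "g \<le> real (card (avail L S \<tau> u))"
        by (auto simp: rich_def)
      moreover have "mate c u = x" using x v that fin by (intro mate_eq[of v]) (auto simp: avail_def)
      ultimately show "mate c u \<in> L u" "X c (mate c u)" "\<And>w. w \<in> S \<Longrightarrow> \<not> X (mate c u) (\<tau> w)"
        "g \<le> real (card (avail L S \<tau> u))" by (auto simp: avail_def)
    qed
    have \<sigma>L: "\<sigma> u \<in> L u" if "u \<in> S" for u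
      using that m \<tau>L by (cases "u \<in> J") (auto simp: \<sigma>J \<sigma>nJ)
    have "\<not> X (\<sigma> u) (\<sigma> w)" if "u \<in> S" "w \<in> S" for u w
      using that \<tau> colourings_no_conflict[OF col, of u w] m(3)[of u w] m(3)[of w u] X_sym[of "\<tau> u" "mate c w"]
      by (cases "u \<in> J"; cases "w \<in> J") (auto simp: \<sigma>J \<sigma>nJ ind_def)
    moreover have "\<sigma> \<in> Pi\<^sub>E S L"
    proof (rule PiE_I)
      fix u assume "u \<notin> S"
      then show "\<sigma> u = undefined" using J col by (subst \<sigma>nJ) (auto simp: colourings_def)
    qed (rule \<sigma>L)
    moreover have "occ S c \<sigma> = J"
    proof -
      have "X c (\<sigma> u) \<longleftrightarrow> u \<in> J" if "u \<in> S" for u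
        using that m(2)[of u] emp[of u] by (cases "u \<in> J") (auto simp: \<sigma>J \<sigma>nJ)
      then show ?thesis using J by (auto simp: occ_def)
    qed
    ultimately have D: "\<sigma> \<in> ?D" by (auto simp: colourings_def)
    have av: "\<tau> u \<in> avail L S \<sigma> u" if "u \<in> J" for u
    proof -
      have "\<not> X (\<tau> u) (\<sigma> w)" if "w \<in> S" for w
        using that \<open>u \<in> J\<close> J colourings_no_conflict[OF col, of u w] m(3)[of w u] X_sym[of "\<tau> u" "mate c w"]
        by (cases "w \<in> J") (auto simp: \<sigma>J \<sigma>nJ)
      then show ?thesis using that J \<tau>L by (auto simp: avail_def)
    qed
    show "?h \<tau> \<in> Sigma ?D ?P" using D av by (auto simp: \<sigma>_def)
    have "(\<Prod>u\<in>J. 1 / (2 * real (card (avail L S \<tau> u)))) \<le> ?w \<sigma>"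
    proof (rule prod_mono)
      fix u assume u: "u \<in> J"
      have uV: "u \<in> V" using u fin by auto
      have "card (avail L S \<sigma> u) \<le> card (avail L S \<tau> u) + card J"
        using fin uV S J \<tau>L \<sigma>nJ by (intro card_avail_change) auto
      then have "real (card (avail L S \<sigma> u)) \<le> 2 * real (card (avail L S \<tau> u))"
        using m(4)[OF u] g by linarith
      moreover have "0 < card (avail L S \<sigma> u)"
        using av[OF u] finite_avail[OF uV] by (auto simp: card_gt_0_iff)
      ultimately show "0 \<le> 1 / (2 * real (card (avail L S \<tau> u))) \<and>
          1 / (2 * real (card (avail L S \<tau> u))) \<le> 1 / real (card (avail L S \<sigma> u))"
        by (auto intro!: divide_left_mono)
    qed
    then show "(\<Prod>u\<in>J. 1 / (2 * real (card (avail L S \<tau> u)))) \<le> ?w (fst (?h \<tau>))"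
      by (simp add: \<sigma>_def)
  qed
  have inj: "inj_on ?h ?T"
  proof (rule inj_onI)
    fix \<tau> \<tau>' assume t: "\<tau> \<in> ?T" "\<tau>' \<in> ?T" "?h \<tau> = ?h \<tau>'"
    show "\<tau> = \<tau>'"
    proof
      fix u
      from t(3) have e: "override_on \<tau> (mate c) J = override_on \<tau>' (mate c) J" "restrict \<tau> J = restrict \<tau>' J"
        by auto
      show "\<tau> u = \<tau>' u"
        using fun_cong[OF e(1), of u] fun_cong[OF e(2), of u]
        by (cases "u \<in> J") auto
    qed
  qed
  have "(\<Sum>\<tau>\<in>?T. \<Prod>u\<in>J. 1 / (2 * real (card (avail L S \<tau> u)))) \<le> (\<Sum>\<tau>\<in>?T. ?w (fst (?h \<tau>)))"
    using wt by (rule sum_mono)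
  also have "\<dots> = (\<Sum>p\<in>?h ` ?T. ?w (fst p))" using inj by (simp only: sum.reindex o_def)
  also have "\<dots> \<le> (\<Sum>p\<in>Sigma ?D ?P. ?w (fst p))"
  proof (rule sum_mono2)
    show "finite (Sigma ?D ?P)" using finc finP by (intro finite_SigmaI) auto
    show "?h ` ?T \<subseteq> Sigma ?D ?P" using mem by (rule image_subsetI)
  qed (auto intro: prod_nonneg)
  also have "\<dots> = (\<Sum>\<sigma>\<in>?D. \<Sum>f\<in>?P \<sigma>. ?w \<sigma>)"
    using finc finP by (subst sum.Sigma) (auto simp: case_prod_beta')
  also have "\<dots> \<le> (\<Sum>\<sigma>\<in>?D. 1)"
  proof (rule sum_mono)
    fix \<sigma>
    have "(\<Sum>f\<in>?P \<sigma>. ?w \<sigma>) = real (card (?P \<sigma>)) * ?w \<sigma>" by simp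
    also have "\<dots> = (\<Prod>u\<in>J. real (card (avail L S \<sigma> u)) * (1 / real (card (avail L S \<sigma> u))))"
      using fin by (simp add: card_PiE prod.distrib del: times_divide_eq_right)
    also have "\<dots> \<le> (\<Prod>u\<in>J. 1)" by (intro prod_mono) auto
    finally show "(\<Sum>f\<in>?P \<sigma>. ?w \<sigma>) \<le> 1" by simp
  qed
  finally show ?thesis by simp
qed

lemma rich_subset_neighbours:
  assumes "v \<in> V" "c \<in> L v" "S \<subseteq> V"
  shows "rich g S c \<sigma> \<subseteq> {u \<in> S. E v u}"
  using assms X_adj by (fastforce simp: rich_def avail_def)

lemma occ_subset_neighbours:
  assumes "v \<in> V" "c \<in> L v" "S \<subseteq> V" "\<sigma> \<in> colourings L S"
  shows "occ S c \<sigma> \<subseteq> {u \<in> S. E v u}"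
  using assms X_adj[of v _ c] colourings_in[of \<sigma> L S] by (fastforce simp: occ_def)

text \<open>Sum \<open>card_occ_eq_le\<close> over the sets of size at most \<open>t\<close> and
  \<open>card_occ_eq_ge\<close> over those of size \<open>a\<close>; at each empty colouring
  \<open>small_sets_dichotomy\<close> compares the two sums. The \<open>a\<close>-sets contribute at
  most \<open>2 * Q / 4 ^ a \<le> \<delta> / 4\<close> times the number of colourings, so half of
  the proportion \<open>\<delta> / 2\<close> assumed in \<open>few\<close> is left for the empty
  colourings.\<close>

lemma card_empty_colourings_ge:
  assumes v: "v \<in> V" "c \<in> L v" and S: "S \<subseteq> V"
    and n: "1 \<le> n" and t: "0 < t" "t \<le> real a" "t \<le> 64 * real n"
    and g: "2 * t + 2 \<le> g" "real a \<le> g"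
    and indep: "\<And>Y. Y \<subseteq> {u \<in> S. E v u} \<Longrightarrow> n \<le> card Y \<Longrightarrow>
      \<exists>J\<subseteq>Y. card J = a \<and> pairwise (\<lambda>u w. \<not> E u w) J"
    and Q: "Q = (64 * exp 1 * real n / t) powr t" "8 * Q \<le> \<delta> * 4 ^ a"
    and few: "\<delta> / 2 * real (card (colourings L S)) \<le>
      real (card {\<sigma> \<in> colourings L S. real (card (occ S c \<sigma>)) \<le> t \<and>
        (\<forall>u\<in>occ S c \<sigma>. g + t \<le> real (card (avail L S \<sigma> u)))})"
  shows "\<delta> / (4 * Q) * real (card (colourings L S)) \<le> real (card (empty_colourings S c))"
proof -
  let ?C = "colourings L S" and ?O = "empty_colourings S c"
  let ?A = "\<lambda>\<tau> u. real (card (avail L S \<tau> u))"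
  let ?lam = "\<lambda>\<tau> u. 1 / (2 * ?A \<tau> u)"
  let ?G = "{\<sigma> \<in> ?C. real (card (occ S c \<sigma>)) \<le> t \<and> (\<forall>u\<in>occ S c \<sigma>. g + t \<le> ?A \<sigma> u)}"
  let ?P = "{J \<in> Pow S. real (card J) \<le> t}" and ?P' = "{J \<in> Pow S. card J = a}"
  have finS: "finite S" using S finite_V finite_subset by blast
  have finC: "finite ?C" using S by (rule finite_colourings_L)
  then have finO: "finite ?O" by (simp add: empty_colourings_def)
  have finR: "finite (rich g S c \<tau>)" for \<tau> using finS by (simp add: rich_def)
  have RS: "rich g S c \<tau> \<subseteq> S" for \<tau> by (auto simp: rich_def)
  have Q0: "0 < Q" unfolding Q(1) using n t by simp
  have "?G \<subseteq> (\<Union>J\<in>?P. {\<sigma> \<in> ?C. occ S c \<sigma> = J \<and> (\<forall>u\<in>J. g + t \<le> ?A \<sigma> u)})"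
    by (auto simp: occ_def)
  then have "card ?G \<le> card (\<Union>J\<in>?P. {\<sigma> \<in> ?C. occ S c \<sigma> = J \<and> (\<forall>u\<in>J. g + t \<le> ?A \<sigma> u)})"
    using finC finS by (intro card_mono) auto
  also have "\<dots> \<le> (\<Sum>J\<in>?P. card {\<sigma> \<in> ?C. occ S c \<sigma> = J \<and> (\<forall>u\<in>J. g + t \<le> ?A \<sigma> u)})"
    using finS by (intro card_UN_le) auto
  finally have "real (card ?G) \<le> real (\<Sum>J\<in>?P. card {\<sigma> \<in> ?C. occ S c \<sigma> = J \<and> (\<forall>u\<in>J. g + t \<le> ?A \<sigma> u)})"
    by (simp only: of_nat_le_iff)
  also have "\<dots> = (\<Sum>J\<in>?P. real (card {\<sigma> \<in> ?C. occ S c \<sigma> = J \<and> (\<forall>u\<in>J. g + t \<le> ?A \<sigma> u)}))" by simp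
  also have "\<dots> \<le> (\<Sum>J\<in>?P. \<Sum>\<tau>\<in>{\<tau> \<in> ?O. J \<subseteq> rich g S c \<tau> \<and> ind c J}. \<Prod>u\<in>J. 2 / ?A \<tau> u)"
    using g by (intro sum_mono card_occ_eq_le[OF v S]) auto
  also have "\<dots> = (\<Sum>\<tau>\<in>?O. \<Sum>J\<in>{J \<in> ?P. J \<subseteq> rich g S c \<tau> \<and> ind c J}. \<Prod>u\<in>J. 2 / ?A \<tau> u)"
    using finO finS by (intro sum.swap_restrict) auto
  also have "\<dots> = (\<Sum>\<tau>\<in>?O. \<Sum>J\<in>{J \<in> Pow (rich g S c \<tau>). ind c J \<and> real (card J) \<le> t}. 4 ^ card J * prod (?lam \<tau>) J)"
  proof (rule sum.cong[OF refl], rule sum.cong)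
    fix \<tau> :: "'a \<Rightarrow> 'c"
    show "{J \<in> ?P. J \<subseteq> rich g S c \<tau> \<and> ind c J} = {J \<in> Pow (rich g S c \<tau>). ind c J \<and> real (card J) \<le> t}"
      using RS by auto
    fix J
    have "4 ^ card J * prod (?lam \<tau>) J = (\<Prod>u\<in>J. 4 * ?lam \<tau> u)" by (simp only: prod.distrib prod_constant)
    then show "(\<Prod>u\<in>J. 2 / ?A \<tau> u) = 4 ^ card J * prod (?lam \<tau>) J" by simp
  qed
  also have "\<dots> \<le> (\<Sum>\<tau>\<in>?O. Q + 2 * Q / 4 ^ a * (\<Sum>J\<in>{J \<in> Pow (rich g S c \<tau>). ind c J \<and> card J = a}. prod (?lam \<tau>) J))"
  proof (rule sum_mono)
    fix \<tau> assume "\<tau> \<in> ?O"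
    show "(\<Sum>J\<in>{J \<in> Pow (rich g S c \<tau>). ind c J \<and> real (card J) \<le> t}. 4 ^ card J * prod (?lam \<tau>) J)
        \<le> Q + 2 * Q / 4 ^ a * (\<Sum>J\<in>{J \<in> Pow (rich g S c \<tau>). ind c J \<and> card J = a}. prod (?lam \<tau>) J)"
      unfolding Q(1)
    proof (rule small_sets_dichotomy[OF finR _ n t])
      fix u assume "u \<in> rich g S c \<tau>"
      then have "1 \<le> ?A \<tau> u" using g t by (auto simp: rich_def)
      then show "0 \<le> ?lam \<tau> u \<and> ?lam \<tau> u \<le> 1" by (auto simp: field_simps)
    next
      fix Y assume Y: "Y \<subseteq> rich g S c \<tau>" "n \<le> card Y"
      then obtain J where J: "J \<subseteq> Y" "card J = a" "pairwise (\<lambda>u w. \<not> E u w) J"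
        using indep rich_subset_neighbours[OF v S] by (meson order_trans)
      have "ind c J"
        unfolding ind_def
      proof (intro ballI notI)
        fix u w assume uw: "u \<in> J" "w \<in> J" "X (mate c u) (mate c w)"
        have m: "mate c u \<in> L u \<and> u \<in> V" if "u \<in> J" for u
        proof -
          have "u \<in> rich g S c \<tau>" using that J Y by auto
          then obtain x where "x \<in> L u" "X c x" "u \<in> V" using S by (auto simp: rich_def avail_def)
          then show ?thesis using mate_eq[OF v, of u x] by simp
        qed
        have "E u w" using X_adj[OF _ _ _ _ uw(3)] m uw by blast
        then show False using J(3) uw(1,2) E_irrefl by (cases "u = w") (auto simp: pairwise_def)
      qed
      then show "\<exists>J\<subseteq>Y. card J = a \<and> ind c J" using J by blast
    qed
  qed
  also have "\<dots> = Q * real (card ?O)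
      + 2 * Q / 4 ^ a * (\<Sum>\<tau>\<in>?O. \<Sum>J\<in>{J \<in> Pow (rich g S c \<tau>). ind c J \<and> card J = a}. prod (?lam \<tau>) J)"
    by (simp add: sum.distrib sum_distrib_left mult.commute)
  finally have upper: "real (card ?G) \<le> Q * real (card ?O) + 2 * Q / 4 ^ a *
      (\<Sum>\<tau>\<in>?O. \<Sum>J\<in>{J \<in> Pow (rich g S c \<tau>). ind c J \<and> card J = a}. prod (?lam \<tau>) J)" .
  have "(\<Sum>\<tau>\<in>?O. \<Sum>J\<in>{J \<in> Pow (rich g S c \<tau>). ind c J \<and> card J = a}. prod (?lam \<tau>) J)
      = (\<Sum>\<tau>\<in>?O. \<Sum>J\<in>{J \<in> ?P'. J \<subseteq> rich g S c \<tau> \<and> ind c J}. prod (?lam \<tau>) J)"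
    using RS by (intro sum.cong refl) auto
  also have "\<dots> = (\<Sum>J\<in>?P'. \<Sum>\<tau>\<in>{\<tau> \<in> ?O. J \<subseteq> rich g S c \<tau> \<and> ind c J}. prod (?lam \<tau>) J)"
    using finO finS by (intro sum.swap_restrict) auto
  also have "\<dots> \<le> (\<Sum>J\<in>?P'. real (card {\<sigma> \<in> ?C. occ S c \<sigma> = J}))"
    using g by (intro sum_mono card_occ_eq_ge[OF v S]) auto
  also have "\<dots> = real (\<Sum>J\<in>?P'. card {\<sigma> \<in> ?C. occ S c \<sigma> = J})" by simp
  also have "(\<Sum>J\<in>?P'. card {\<sigma> \<in> ?C. occ S c \<sigma> = J}) = card (\<Union>J\<in>?P'. {\<sigma> \<in> ?C. occ S c \<sigma> = J})"
    using finS finC by (intro card_UN_disjoint[symmetric]) auto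
  also have "real \<dots> \<le> real (card ?C)"
    using finC by (intro of_nat_mono card_mono) auto
  finally have "2 * Q / 4 ^ a * (\<Sum>\<tau>\<in>?O. \<Sum>J\<in>{J \<in> Pow (rich g S c \<tau>). ind c J \<and> card J = a}. prod (?lam \<tau>) J)
      \<le> 2 * Q / 4 ^ a * real (card ?C)"
    using Q0 by (intro mult_left_mono) auto
  moreover have "2 * Q / 4 ^ a * real (card ?C) \<le> \<delta> / 4 * real (card ?C)"
    using Q(2) by (intro mult_right_mono) (auto simp: field_simps)
  ultimately have "\<delta> / 4 * real (card ?C) \<le> Q * real (card ?O)" using few upper by linarith
  then show ?thesis using Q0 by (simp add: field_simps)
qed

section \<open>Growth of the number of colourings when a vertex is added\<close>

lemma sum_card_occ_le:
  assumes v: "v \<in> V" and S: "S \<subseteq> V" and \<sigma>: "\<sigma> \<in> colourings L S" and D: "D \<subseteq> {u \<in> S. E v u}"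
  shows "(\<Sum>c\<in>L v. card (occ S c \<sigma> \<inter> D)) \<le> card D"
proof -
  have finD: "finite D" using D S finite_V by (auto intro: finite_subset)
  have "(\<Sum>c\<in>L v. card (occ S c \<sigma> \<inter> D)) = (\<Sum>c\<in>L v. \<Sum>u\<in>{u \<in> D. X c (\<sigma> u)}. 1)"
    using D by (intro sum.cong) (auto simp: occ_def intro!: arg_cong[where f = card])
  also have "\<dots> = (\<Sum>u\<in>D. \<Sum>c\<in>{c \<in> L v. X c (\<sigma> u)}. 1)"
    using finD finite_L[OF v] by (intro sum.swap_restrict) auto
  also have "\<dots> \<le> (\<Sum>u\<in>D. 1)"
  proof (rule sum_mono)
    fix u assume "u \<in> D"
    then have "card {c \<in> L v. X c (\<sigma> u)} \<le> 1"
      using D S v colourings_in[OF \<sigma>, of u] by (intro card_conflicting_le_1[of v u]) auto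
    then show "(\<Sum>c\<in>{c \<in> L v. X c (\<sigma> u)}. 1) \<le> (1::nat)" by simp
  qed
  finally show ?thesis by simp
qed

text \<open>Discard the colours of \<open>v\<close> that are blocked on average by more than
  \<open>(1 - \<delta>) * t\<close> neighbours, or by more than \<open>\<delta> / 2\<close>
  neighbours with few available colours; by \<open>q\<close> a proportion of at least
  \<open>\<delta>\<close> of the list survives. For a survivor Markov's inequality leaves
  probability at least \<open>1 - (1 - \<delta>) - \<delta> / 2 = \<delta> / 2\<close> that at most
  \<open>t\<close> neighbours block it, all with many available colours. The factor
  \<open>\<xi>\<close> bounds the probability that a given neighbour has few.\<close>

lemma card_colourings_extend:
  assumes v: "v \<in> V" and S: "S \<subseteq> V" "v \<notin> S"
    and IH: "\<And>u. u \<in> S \<Longrightarrow> E v u \<Longrightarrow> \<beta> u * real (card (colourings L (S - {u}))) \<le> real (card (colourings L S))"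
    and d: "real (card {u \<in> S. E v u}) \<le> d"
    and n: "1 \<le> n" and t: "0 < t" "t \<le> real a" "t \<le> 64 * real n"
    and g: "2 * t + 2 \<le> g" "real a \<le> g"
    and indep: "\<And>Y. Y \<subseteq> {u \<in> S. E v u} \<Longrightarrow> n \<le> card Y \<Longrightarrow>
      \<exists>J\<subseteq>Y. card J = a \<and> pairwise (\<lambda>u w. \<not> E u w) J"
    and Q: "Q = (64 * exp 1 * real n / t) powr t" "8 * Q \<le> \<delta> * 4 ^ a"
    and \<delta>: "0 < \<delta>" "\<delta> < 1" and \<xi>: "0 \<le> \<xi>"
    and \<beta>: "\<And>u. u \<in> S \<Longrightarrow> E v u \<Longrightarrow> g + t \<le> \<xi> * \<beta> u"
    and q: "d / ((1 - \<delta>) * t) + 2 * \<xi> * d / \<delta> \<le> (1 - \<delta>) * real (card (L v))"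
  shows "\<delta>\<^sup>2 * real (card (L v)) / (4 * Q) * real (card (colourings L S))
    \<le> real (card (colourings L (insert v S)))"
proof (cases "colourings L S = {}")
  case True
  then show ?thesis by simp
next
  case False
  let ?C = "colourings L S" and ?N = "{u \<in> S. E v u}"
  let ?A = "\<lambda>\<sigma> u. real (card (avail L S \<sigma> u))"
  let ?poor = "\<lambda>\<sigma>. {u \<in> ?N. ?A \<sigma> u < g + t}"
  let ?c = "real (card ?C)"
  have finC: "finite ?C" using S(1) by (rule finite_colourings_L)
  have finN: "finite ?N" using S finite_V by (auto intro: finite_subset)
  have finLv: "finite (L v)" using v by (rule finite_L)
  have C0: "0 < ?c" using False finC by (simp add: card_gt_0_iff)
  have Q0: "0 < Q" unfolding Q(1) using n t by simp
  \<comment> \<open>Expectations without the factor \<open>1 / card ?C\<close>: of the number of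
    neighbours blocking \<open>c\<close>, and of the poor ones among them.\<close>
  define tot where "tot c = (\<Sum>\<sigma>\<in>?C. real (card (occ S c \<sigma>)))" for c
  define poo where "poo c = (\<Sum>\<sigma>\<in>?C. real (card (occ S c \<sigma> \<inter> ?poor \<sigma>)))" for c
  have occN: "occ S c \<sigma> \<subseteq> ?N" if "c \<in> L v" "\<sigma> \<in> ?C" for c \<sigma>
    using occ_subset_neighbours[OF v that(1) S(1) that(2)] .
  have "(\<Sum>c\<in>L v. tot c) = (\<Sum>\<sigma>\<in>?C. \<Sum>c\<in>L v. real (card (occ S c \<sigma>)))"
    unfolding tot_def by (rule sum.swap)
  also have "\<dots> \<le> (\<Sum>\<sigma>\<in>?C. d)"
  proof (rule sum_mono)
    fix \<sigma> assume s: "\<sigma> \<in> ?C"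
    have "(\<Sum>c\<in>L v. card (occ S c \<sigma>)) = (\<Sum>c\<in>L v. card (occ S c \<sigma> \<inter> ?N))"
      using occN s by (intro sum.cong refl arg_cong[where f = card]) auto
    also have "\<dots> \<le> card ?N" using sum_card_occ_le[OF v S(1) s] by simp
    finally have "real (\<Sum>c\<in>L v. card (occ S c \<sigma>)) \<le> real (card ?N)" by (simp only: of_nat_le_iff)
    then show "(\<Sum>c\<in>L v. real (card (occ S c \<sigma>))) \<le> d" using d by simp
  qed
  finally have tot: "(\<Sum>c\<in>L v. tot c) \<le> d * ?c" by (simp add: mult.commute)
  have "(\<Sum>c\<in>L v. poo c) = (\<Sum>\<sigma>\<in>?C. \<Sum>c\<in>L v. real (card (occ S c \<sigma> \<inter> ?poor \<sigma>)))"
    unfolding poo_def by (rule sum.swap)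
  also have "\<dots> \<le> (\<Sum>\<sigma>\<in>?C. real (card (?poor \<sigma>)))"
  proof (rule sum_mono)
    fix \<sigma> assume s: "\<sigma> \<in> ?C"
    have "real (\<Sum>c\<in>L v. card (occ S c \<sigma> \<inter> ?poor \<sigma>)) \<le> real (card (?poor \<sigma>))"
      unfolding of_nat_le_iff by (rule sum_card_occ_le[OF v S(1) s]) auto
    then show "(\<Sum>c\<in>L v. real (card (occ S c \<sigma> \<inter> ?poor \<sigma>))) \<le> real (card (?poor \<sigma>))" by simp
  qed
  also have "\<dots> = (\<Sum>\<sigma>\<in>?C. \<Sum>u\<in>{u \<in> ?N. ?A \<sigma> u < g + t}. 1)" by simp
  also have "\<dots> = (\<Sum>u\<in>?N. \<Sum>\<sigma>\<in>{\<sigma> \<in> ?C. ?A \<sigma> u < g + t}. 1)"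
    using finC finN by (intro sum.swap_restrict) auto
  also have "\<dots> \<le> (\<Sum>u\<in>?N. \<xi> * ?c)"
  proof (rule sum_mono)
    fix u assume u: "u \<in> ?N"
    have "real (card {\<sigma> \<in> ?C. ?A \<sigma> u < g + t}) \<le> (g + t) * real (card (colourings L (S - {u})))"
      using u S g t by (intro card_few_available_le) auto
    also have "\<dots> \<le> (\<xi> * \<beta> u) * real (card (colourings L (S - {u})))"
      using \<beta> u by (intro mult_right_mono) auto
    also have "\<dots> = \<xi> * (\<beta> u * real (card (colourings L (S - {u}))))" by simp
    also have "\<dots> \<le> \<xi> * ?c" using IH u \<xi> by (intro mult_left_mono) auto
    finally show "(\<Sum>\<sigma>\<in>{\<sigma> \<in> ?C. ?A \<sigma> u < g + t}. 1) \<le> \<xi> * ?c" by simp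
  qed
  also have "\<dots> = real (card ?N) * (\<xi> * ?c)" by simp
  also have "\<dots> \<le> d * (\<xi> * ?c)" using d \<xi> by (intro mult_right_mono) auto
  finally have poo: "(\<Sum>c\<in>L v. poo c) \<le> \<xi> * d * ?c" by (simp add: mult_ac)
  have tot0: "0 \<le> tot c" and poo0: "0 \<le> poo c" for c
    unfolding tot_def poo_def by (auto intro: sum_nonneg)
  define B1 where "B1 = {c \<in> L v. (1 - \<delta>) * t * ?c < tot c}"
  define B2 where "B2 = {c \<in> L v. \<delta> / 2 * ?c < poo c}"
  define Gd where "Gd = L v - B1 - B2"
  have fB: "finite B1" "finite B2" "B1 \<subseteq> L v" "B2 \<subseteq> L v" using finLv by (auto simp: B1_def B2_def)
  have "real (card B1) * ((1 - \<delta>) * t * ?c) = (\<Sum>c\<in>B1. (1 - \<delta>) * t * ?c)" by simp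
  also have "\<dots> \<le> (\<Sum>c\<in>B1. tot c)" by (intro sum_mono) (auto simp: B1_def)
  also have "\<dots> \<le> (\<Sum>c\<in>L v. tot c)" using fB finLv tot0 by (intro sum_mono2) auto
  also have "\<dots> \<le> d * ?c" by (rule tot)
  finally have "real (card B1) * ((1 - \<delta>) * t) * ?c \<le> d * ?c" by (simp only: mult.assoc)
  then have "real (card B1) * ((1 - \<delta>) * t) \<le> d" using C0 by (simp only: mult_le_cancel_right_pos)
  then have b1: "real (card B1) \<le> d / ((1 - \<delta>) * t)" using \<delta> t by (simp add: pos_le_divide_eq)
  have "real (card B2) * (\<delta> / 2 * ?c) = (\<Sum>c\<in>B2. \<delta> / 2 * ?c)" by simp
  also have "\<dots> \<le> (\<Sum>c\<in>B2. poo c)" by (intro sum_mono) (auto simp: B2_def)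
  also have "\<dots> \<le> (\<Sum>c\<in>L v. poo c)" using fB finLv poo0 by (intro sum_mono2) auto
  also have "\<dots> \<le> \<xi> * d * ?c" by (rule poo)
  finally have "real (card B2) * (\<delta> / 2) * ?c \<le> \<xi> * d * ?c" by (simp only: mult.assoc)
  then have "real (card B2) * (\<delta> / 2) \<le> \<xi> * d" using C0 by (simp only: mult_le_cancel_right_pos)
  then have b2: "real (card B2) \<le> 2 * \<xi> * d / \<delta>" using \<delta> by (simp add: field_simps)
  have "card (L v) \<le> card Gd + card B1 + card B2"
  proof -
    have "L v \<subseteq> Gd \<union> B1 \<union> B2" by (auto simp: Gd_def)
    then have "card (L v) \<le> card (Gd \<union> B1 \<union> B2)" using fB finLv by (intro card_mono) (auto simp: Gd_def)
    also have "\<dots> \<le> card (Gd \<union> B1) + card B2" by (rule card_Un_le)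
    also have "card (Gd \<union> B1) \<le> card Gd + card B1" by (rule card_Un_le)
    finally show ?thesis by simp
  qed
  then have "real (card (L v)) \<le> real (card Gd) + real (card B1) + real (card B2)"
    by (simp flip: of_nat_add)
  then have Gd: "\<delta> * real (card (L v)) \<le> real (card Gd)" using b1 b2 q by (simp add: algebra_simps)
  have empty: "\<delta> / (4 * Q) * ?c \<le> real (card (empty_colourings S c))" if c: "c \<in> Gd" for c
  proof (rule card_empty_colourings_ge[OF v _ S(1) n t g indep Q])
    show cL: "c \<in> L v" using c by (simp add: Gd_def)
    have c1: "tot c \<le> (1 - \<delta>) * t * ?c" and c2: "poo c \<le> \<delta> / 2 * ?c"
      using c by (auto simp: Gd_def B1_def B2_def)
    let ?G = "{\<sigma> \<in> ?C. real (card (occ S c \<sigma>)) \<le> t \<and> (\<forall>u\<in>occ S c \<sigma>. g + t \<le> ?A \<sigma> u)}"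
    let ?X1 = "{\<sigma> \<in> ?C. t < real (card (occ S c \<sigma>))}"
    let ?X2 = "{\<sigma> \<in> ?C. occ S c \<sigma> \<inter> ?poor \<sigma> \<noteq> {}}"
    have finocc: "finite (occ S c \<sigma>)" for \<sigma> using S finite_V by (auto simp: occ_def intro: finite_subset)
    have "real (card ?X1) * t = (\<Sum>\<sigma>\<in>?X1. t)" by simp
    also have "\<dots> \<le> (\<Sum>\<sigma>\<in>?X1. real (card (occ S c \<sigma>)))" by (intro sum_mono) auto
    also have "\<dots> \<le> tot c" unfolding tot_def using finC by (intro sum_mono2) auto
    also have "\<dots> \<le> ((1 - \<delta>) * ?c) * t" using c1 by (simp add: mult_ac)
    finally have x1: "real (card ?X1) \<le> (1 - \<delta>) * ?c" using t by (simp only: mult_le_cancel_right_pos)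
    have "real (card ?X2) = (\<Sum>\<sigma>\<in>?X2. 1)" by simp
    also have "\<dots> \<le> (\<Sum>\<sigma>\<in>?X2. real (card (occ S c \<sigma> \<inter> ?poor \<sigma>)))"
    proof (rule sum_mono)
      fix \<sigma> assume "\<sigma> \<in> ?X2"
      then have "0 < card (occ S c \<sigma> \<inter> ?poor \<sigma>)" using finocc by (simp add: card_gt_0_iff)
      then show "1 \<le> real (card (occ S c \<sigma> \<inter> ?poor \<sigma>))" by linarith
    qed
    also have "\<dots> \<le> poo c" unfolding poo_def using finC by (intro sum_mono2) auto
    finally have x2: "real (card ?X2) \<le> \<delta> / 2 * ?c" using c2 by linarith
    have "?C \<subseteq> ?G \<union> ?X1 \<union> ?X2"
    proof
      fix \<sigma> assume s: "\<sigma> \<in> ?C"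
      show "\<sigma> \<in> ?G \<union> ?X1 \<union> ?X2"
      proof (rule ccontr)
        assume a: "\<not> ?thesis"
        then obtain u where "u \<in> occ S c \<sigma>" "?A \<sigma> u < g + t" using s by (auto simp: not_le not_less)
        then show False using occN[OF cL s] a s by blast
      qed
    qed
    then have "card ?C \<le> card (?G \<union> ?X1 \<union> ?X2)" using finC by (intro card_mono) auto
    also have "\<dots> \<le> card (?G \<union> ?X1) + card ?X2" by (rule card_Un_le)
    also have "card (?G \<union> ?X1) \<le> card ?G + card ?X1" by (rule card_Un_le)
    finally have "?c \<le> real (card ?G) + real (card ?X1) + real (card ?X2)" by (simp flip: of_nat_add)
    then show "\<delta> / 2 * ?c \<le> real (card ?G)" using x1 x2 by (simp add: algebra_simps)
  qed
  have "\<delta>\<^sup>2 * real (card (L v)) / (4 * Q) * ?c = (\<delta> * real (card (L v))) * (\<delta> / (4 * Q) * ?c)"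
    by (simp add: power2_eq_square)
  also have "\<dots> \<le> real (card Gd) * (\<delta> / (4 * Q) * ?c)"
    using Gd \<delta> Q0 by (intro mult_right_mono) auto
  also have "\<dots> = (\<Sum>c\<in>Gd. \<delta> / (4 * Q) * ?c)" by simp
  also have "\<dots> \<le> (\<Sum>c\<in>Gd. real (card (empty_colourings S c)))" using empty by (rule sum_mono)
  also have "\<dots> \<le> (\<Sum>c\<in>L v. real (card (empty_colourings S c)))"
    using finLv by (intro sum_mono2) (auto simp: Gd_def)
  also have "\<dots> = (\<Sum>c\<in>L v. \<Sum>\<sigma>\<in>{\<sigma> \<in> ?C. \<forall>w\<in>S. \<not> X c (\<sigma> w)}. 1)"
    by (auto intro!: sum.cong arg_cong[where f = card] simp: empty_colourings_def occ_def)
  also have "\<dots> = (\<Sum>\<sigma>\<in>?C. \<Sum>c\<in>{c \<in> L v. \<forall>w\<in>S. \<not> X c (\<sigma> w)}. 1)"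
    using finC finLv by (intro sum.swap_restrict) auto
  also have "\<dots> = real (\<Sum>\<sigma>\<in>?C. card (avail L S \<sigma> v))" by (simp add: avail_def)
  also have "(\<Sum>\<sigma>\<in>?C. card (avail L S \<sigma> v)) = card (colourings L (insert v S))"
    using v S by (intro card_colourings_insert[symmetric]) auto
  finally show ?thesis .
qed

text \<open>Induction on \<open>card S\<close> for all vertices at once, because the step at
  \<open>v\<close> needs the growth from \<open>S - {u}\<close> to \<open>S\<close> for every
  neighbour \<open>u\<close>. Hypothesis \<open>\<beta>\<close> is where vertices of different
  degrees meet: the colours wanted on behalf of \<open>v\<close> are measured against the growth at
  \<open>u\<close>.\<close>

lemma colourings_nonempty:
  fixes d t \<xi> Q :: "'a \<Rightarrow> real" and n a :: "'a \<Rightarrow> nat" and \<delta> :: real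
  defines "\<beta> \<equiv> \<lambda>v. \<delta>\<^sup>2 * real (card (L v)) / (4 * Q v)"
  assumes L: "\<And>v. v \<in> V \<Longrightarrow> L v \<noteq> {}"
    and d: "\<And>v. v \<in> V \<Longrightarrow> real (card {u \<in> V. E v u}) \<le> d v"
    and n: "\<And>v. v \<in> V \<Longrightarrow> 1 \<le> n v"
    and t: "\<And>v. v \<in> V \<Longrightarrow> 0 < t v" "\<And>v. v \<in> V \<Longrightarrow> t v \<le> real (a v)" "\<And>v. v \<in> V \<Longrightarrow> t v \<le> 64 * real (n v)"
    and indep: "\<And>v Y. v \<in> V \<Longrightarrow> Y \<subseteq> {u \<in> V. E v u} \<Longrightarrow> n v \<le> card Y \<Longrightarrow>
      \<exists>J\<subseteq>Y. card J = a v \<and> pairwise (\<lambda>u w. \<not> E u w) J"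
    and Q: "\<And>v. v \<in> V \<Longrightarrow> Q v = (64 * exp 1 * real (n v) / t v) powr t v"
      "\<And>v. v \<in> V \<Longrightarrow> 8 * Q v \<le> \<delta> * 4 ^ a v"
    and \<delta>: "0 < \<delta>" "\<delta> < 1" and \<xi>: "\<And>v. v \<in> V \<Longrightarrow> 0 \<le> \<xi> v"
    and \<beta>: "\<And>u v. u \<in> V \<Longrightarrow> v \<in> V \<Longrightarrow> 3 * real (a v) + 2 \<le> \<xi> v * \<beta> u"
    and q: "\<And>v. v \<in> V \<Longrightarrow> d v / ((1 - \<delta>) * t v) + 2 * \<xi> v * d v / \<delta> \<le> (1 - \<delta>) * real (card (L v))"
  shows "colourings L V \<noteq> {}"
proof -
  have extend: "\<beta> v * real (card (colourings L S)) \<le> real (card (colourings L (insert v S)))"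
    if "S \<subseteq> V" "v \<in> V - S" for S v
    using that
  proof (induction "card S" arbitrary: S v rule: less_induct)
    case less
    have v: "v \<in> V" "v \<notin> S" and S: "S \<subseteq> V" using less.prems by auto
    have finS: "finite S" using S finite_V finite_subset by blast
    have sub: "{u \<in> S. E v u} \<subseteq> {u \<in> V. E v u}" using S by auto
    have \<beta>v: "\<beta> v = \<delta>\<^sup>2 * real (card (L v)) / (4 * Q v)" by (simp add: \<beta>_def)
    show ?case
      unfolding \<beta>v
    \<comment> \<open>As \<open>t v \<le> a v\<close>, this \<open>g\<close> meets both lower bounds
      on it, and \<open>g + t v\<close> is at most the \<open>3 * a v + 2\<close> of hypothesis
      \<open>\<beta>\<close>.\<close>
    proof (rule card_colourings_extend[OF v(1) S v(2), where g = "2 * real (a v) + 2" and \<xi> = "\<xi> v" and \<beta> = \<beta> and d = "d v"])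
      fix u assume u: "u \<in> S"
      have "card (S - {u}) < card S" using u finS by (intro psubset_card_mono) auto
      from less.hyps[OF this, of u]
      show "\<beta> u * real (card (colourings L (S - {u}))) \<le> real (card (colourings L S))"
        using u S by (auto simp: insert_absorb)
      show "2 * real (a v) + 2 + t v \<le> \<xi> v * \<beta> u" using \<beta>[of u v] t(2)[of v] u S v by auto
    next
      have "card {u \<in> S. E v u} \<le> card {u \<in> V. E v u}" using finite_V sub by (intro card_mono) auto
      then show "real (card {u \<in> S. E v u}) \<le> d v" using d[OF v(1)] by linarith
    next
      fix Y assume "Y \<subseteq> {u \<in> S. E v u}" "n v \<le> card Y"
      then show "\<exists>J\<subseteq>Y. card J = a v \<and> pairwise (\<lambda>u w. \<not> E u w) J"
        using indep[OF v(1)] sub by (meson order_trans)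
    qed (use n t Q \<delta> \<xi> q v t(2)[of v] in auto)
  qed
  have Q0: "0 < Q v" if "v \<in> V" for v
    using Q(1)[OF that] n[OF that] t(1)[OF that] by simp
  have \<beta>0: "0 < \<beta> v" if "v \<in> V" for v
    using Q0[OF that] L[OF that] finite_L[OF that] \<delta> by (simp add: \<beta>_def card_gt_0_iff)
  have "0 < card (colourings L S)" if "finite S" "S \<subseteq> V" for S
    using that
  proof (induction S rule: finite_induct)
    case empty
    then show ?case by (simp add: colourings_def)
  next
    case (insert v S)
    have "0 < \<beta> v * real (card (colourings L S))" using insert \<beta>0 by simp
    also have "\<dots> \<le> real (card (colourings L (insert v S)))" using insert by (intro extend) auto
    finally show ?case by simp
  qed
  from this[OF finite_V] show ?thesis by auto
qed

end

section \<open>Choice of the parameters\<close>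

text \<open>Here \<open>z\<close> is \<open>ln d\<close>. The bound on \<open>ln w\<close> is asked
  for all large \<open>w\<close> since it is applied to \<open>weight\<close>, for which only a
  lower bound is at hand; \<open>K\<close> will be the logarithm of
  \<open>40 / \<delta> ^ 4\<close>.\<close>

lemma eventually_large_degree:
  fixes \<mu> \<delta> \<zeta> :: real
  assumes "0 < \<mu>" "0 < \<delta>" "0 < \<zeta>"
  shows "eventually (\<lambda>z. 5 \<le> z \<and> 1 \<le> ln z \<and> 10 \<le> \<zeta> * ln z \<and> (\<forall>w\<ge>ln z. ln w \<le> \<zeta> / 2 * w) \<and>
    8 \<le> \<delta> * exp z \<and> ln z + K \<le> \<zeta> * z) at_top"
proof -
  have "eventually (\<lambda>w::real. ln w \<le> \<zeta> / 2 * w) at_top" using assms(3) by real_asymp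
  then obtain w0 where w0: "\<And>w. w0 \<le> w \<Longrightarrow> ln w \<le> \<zeta> / 2 * w" by (auto simp: eventually_at_top_linorder)
  have "eventually (\<lambda>z::real. w0 \<le> ln z) at_top" by real_asymp
  then have "eventually (\<lambda>z. \<forall>w\<ge>ln z. ln w \<le> \<zeta> / 2 * w) at_top"
    by eventually_elim (use w0 in auto)
  moreover have "eventually (\<lambda>z::real. 5 \<le> z) at_top" "eventually (\<lambda>z::real. 1 \<le> ln z) at_top"
    by real_asymp+
  moreover have "eventually (\<lambda>z::real. 10 \<le> \<zeta> * ln z) at_top" "eventually (\<lambda>z. ln z + K \<le> \<zeta> * z) at_top"
    using assms(3) by real_asymp+
  moreover have "eventually (\<lambda>z. 8 \<le> \<delta> * exp z) at_top" using assms(2) by real_asymp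
  ultimately show ?thesis by eventually_elim blast
qed

text \<open>Used with \<open>C = 16 / \<mu>\<close>. The last two conditions serve degrees below the
  power \<open>C\<close> of \<open>ln D\<close>: one forces the exponent maximum to be small there,
  the other yields \<open>e * ln d \<le> 1\<close>.\<close>

lemma eventually_large_max_degree:
  fixes C :: real
  assumes "0 < C"
  shows "eventually (\<lambda>D. 1 \<le> ln D \<and> z0 \<le> ln (ln D) \<and> 2 * C * ln (ln D) < ln D \<and> C\<^sup>2 * (ln (ln D))\<^sup>2 \<le> 2 * ln D) at_top"
proof (intro eventually_conj)
  show "eventually (\<lambda>D::real. 1 \<le> ln D) at_top" "eventually (\<lambda>D::real. z0 \<le> ln (ln D)) at_top"
    by real_asymp+
  show "eventually (\<lambda>D. 2 * C * ln (ln D) < ln D) at_top" "eventually (\<lambda>D. C\<^sup>2 * (ln (ln D))\<^sup>2 \<le> 2 * ln D) at_top"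
    by real_asymp+
qed

text \<open>In the counting step at a vertex of degree \<open>d\<close>, every set of \<open>forcing_size\<close> neighbours contains
  an independent set of size \<open>set_size\<close>, and a colour that conflicts with the colours of at most
  \<open>threshold\<close> neighbours on average is available in a proportion of about \<open>1 / loss\<close> of the colourings.\<close>

definition set_size :: "real \<Rightarrow> nat" where
  "set_size d = nat \<lceil>2 * ln d\<rceil>"

definition forcing_size :: "real \<Rightarrow> nat \<Rightarrow> real \<Rightarrow> nat" where
  "forcing_size d r e = nat \<lfloor>real (set_size d) ^ (r - 1) * d powr e\<rfloor> + 1"

text \<open>The logarithm of \<open>d powr e * ln d ^ r\<close>, which is \<open>ln d\<close> times
  the bracket in the list-size hypothesis.\<close>

definition weight :: "real \<Rightarrow> nat \<Rightarrow> real \<Rightarrow> real" where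
  "weight d r e = e * ln d + real r * ln (ln d)"

definition threshold :: "real \<Rightarrow> real \<Rightarrow> nat \<Rightarrow> real \<Rightarrow> real" where
  "threshold \<mu> d r e = ln d / ((1 + \<mu> / 2) * weight d r e)"

definition loss :: "real \<Rightarrow> real \<Rightarrow> nat \<Rightarrow> real \<Rightarrow> real" where
  "loss \<mu> d r e = (64 * exp 1 * real (forcing_size d r e) / threshold \<mu> d r e) powr threshold \<mu> d r e"

context
  fixes \<mu> d e :: real and r :: nat
  assumes \<mu>: "0 < \<mu>" "\<mu> \<le> 1" and d: "0 < d" and e: "0 \<le> e" and r: "3 \<le> r"
    and z: "5 \<le> ln d" "1 \<le> ln (ln d)" "10 \<le> \<mu> / 24 * ln (ln d)"
      "\<forall>w\<ge>ln (ln d). ln w \<le> \<mu> / 24 / 2 * w" "8 \<le> \<mu> / 16 * exp (ln d)"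
begin

section \<open>Estimates for the parameters at a single vertex\<close>

lemma d_ge_1: "1 \<le> d"
  using ln_less_zero[of d] z(1) d by linarith

lemma weight_ge: "3 * ln (ln d) \<le> weight d r e" "real r * ln (ln d) \<le> weight d r e" "3 \<le> weight d r e"
proof -
  have "3 * ln (ln d) \<le> real r * ln (ln d)" using r z by (intro mult_right_mono) auto
  moreover have "0 \<le> e * ln d" using e z by simp
  ultimately show "3 * ln (ln d) \<le> weight d r e" "real r * ln (ln d) \<le> weight d r e" "3 \<le> weight d r e"
    using z unfolding weight_def by linarith+
qed

lemma set_size_bounds: "2 * ln d \<le> real (set_size d)" "real (set_size d) \<le> 3 * ln d" "real (set_size d) \<le> 2 * ln d + 1" "2 \<le> set_size d"
proof -
  show 1: "2 * ln d \<le> real (set_size d)" unfolding set_size_def by linarith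
  show 2: "real (set_size d) \<le> 2 * ln d + 1" unfolding set_size_def using z by linarith
  show "real (set_size d) \<le> 3 * ln d" using 2 z by linarith
  show "2 \<le> set_size d" using 1 z by linarith
qed

lemma threshold_bounds: "0 < threshold \<mu> d r e" "threshold \<mu> d r e \<le> ln d"
    "threshold \<mu> d r e \<le> real (set_size d)" "threshold \<mu> d r e \<le> 64 * real (forcing_size d r e)"
proof -
  have w: "3 \<le> weight d r e" by (rule weight_ge)
  have "1 * 1 \<le> (1 + \<mu> / 2) * weight d r e" using w \<mu> by (intro mult_mono) auto
  then show t0: "0 < threshold \<mu> d r e" and t1: "threshold \<mu> d r e \<le> ln d"
    using z by (auto simp: threshold_def divide_le_eq)
  show t2: "threshold \<mu> d r e \<le> real (set_size d)" using t1 set_size_bounds z by linarith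
  have "real (set_size d) ^ 1 \<le> real (set_size d) ^ (r - 1)"
    using set_size_bounds r by (intro power_increasing) auto
  also have "\<dots> = real (set_size d) ^ (r - 1) * 1" by simp
  also have "\<dots> \<le> real (set_size d) ^ (r - 1) * d powr e"
    using d_ge_1 e by (intro mult_left_mono ge_one_powr_ge_zero) auto
  also have "\<dots> \<le> real (forcing_size d r e)" unfolding forcing_size_def by linarith
  finally show "threshold \<mu> d r e \<le> 64 * real (forcing_size d r e)" using t2 by simp
qed

lemma forcing_size_gt: "real (set_size d) ^ (r - 1) * d powr e < real (forcing_size d r e)"
  unfolding forcing_size_def by linarith

text \<open>The main term is \<open>threshold * (weight - 2 * ln (ln d))\<close>, where
  \<open>threshold * weight = ln d / (1 + \<mu> / 2)\<close>; all errors are absorbed by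
  \<open>\<mu> / 24 * weight\<close>.\<close>

lemma ln_loss_le: "ln (loss \<mu> d r e) \<le> ln d * (1 + \<mu> / 24 - 2 * ln (ln d) / weight d r e) / (1 + \<mu> / 2)"
proof -
  define w where "w = weight d r e"
  define b where "b = ln (ln d)"
  define t where "t = threshold \<mu> d r e"
  define n where "n = forcing_size d r e"
  have w: "3 * b \<le> w" "real r * b \<le> w" "3 \<le> w" using weight_ge by (auto simp: w_def b_def)
  have t0: "0 < t" using threshold_bounds by (simp add: t_def)
  have dge1: "1 \<le> d powr e"
    using d_ge_1 e by (intro ge_one_powr_ge_zero) auto
  have "1 \<le> real (set_size d) ^ (r - 1)" using set_size_bounds by (intro one_le_power) auto
  then have big: "1 \<le> real (set_size d) ^ (r - 1) * d powr e"
    using dge1 mult_mono[of 1 "real (set_size d) ^ (r - 1)" 1 "d powr e"] by simp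
  have n1: "1 \<le> n" by (simp add: n_def forcing_size_def)
  have "real n \<le> real (set_size d) ^ (r - 1) * d powr e + 1"
    unfolding n_def forcing_size_def using big by linarith
  also have "\<dots> \<le> 2 * (real (set_size d) ^ (r - 1) * d powr e)" using big by linarith
  also have "\<dots> \<le> 2 * ((3 * ln d) ^ (r - 1) * d powr e)"
    using set_size_bounds by (intro mult_left_mono mult_right_mono power_mono) auto
  finally have "ln (real n) \<le> ln (2 * ((3 * ln d) ^ (r - 1) * d powr e))" using n1 by simp
  also have "\<dots> = ln 2 + (real (r - 1) * (ln 3 + b) + e * ln d)"
  proof -
    have "0 < 3 * ln d" using z by linarith
    then have "ln ((3 * ln d) ^ (r - 1)) = real (r - 1) * (ln 3 + b)" "0 < (3 * ln d) ^ (r - 1)"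
      by (simp_all add: ln_realpow ln_mult b_def distrib_left)
    moreover have "ln (d powr e) = e * ln d" "0 < d powr e" using d by (simp_all add: ln_powr)
    ultimately show ?thesis by (simp only: ln_mult_pos zero_less_numeral mult_pos_pos)
  qed
  finally have lnn: "ln (real n) \<le> ln 2 + real (r - 1) * (ln 3 + b) + e * ln d" by simp
  have "ln t = b - (ln (1 + \<mu> / 2) + ln w)"
    using z \<mu> w by (simp add: t_def threshold_def ln_div ln_mult b_def w_def)
  moreover have "ln (64 * exp 1 * real n / t) = ln 64 + 1 + ln (real n) - ln t"
    using n1 t0 by (simp add: ln_div ln_mult)
  ultimately have "ln (64 * exp 1 * real n / t)
      \<le> ln 64 + 1 + (ln 2 + real (r - 1) * (ln 3 + b) + e * ln d) - b + ln (1 + \<mu> / 2) + ln w"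
    using lnn by linarith
  also have "real (r - 1) * (ln 3 + b) = (real r - 1) * ln 3 + (real r - 1) * b"
    using r by (simp add: of_nat_diff algebra_simps)
  also have "ln 64 + 1 + (ln 2 + ((real r - 1) * ln 3 + (real r - 1) * b) + e * ln d) - b + ln (1 + \<mu> / 2) + ln w
      = (w - 2 * b) + (ln 64 + 1 + ln 2 + (real r - 1) * ln 3 + ln (1 + \<mu> / 2) + ln w)"
    by (simp add: w_def weight_def b_def algebra_simps)
  \<comment> \<open>Half of the allowance pays for \<open>ln w\<close>. The other half pays for the
    constants and the terms linear in \<open>r\<close>, together at most
    \<open>7 + 2 * r \<le> 5 * r\<close>.\<close>
  also have "ln 64 + 1 + ln 2 + (real r - 1) * ln 3 + ln (1 + \<mu> / 2) + ln w \<le> \<mu> / 24 * w"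
  proof -
    have l2: "ln 2 \<le> (1::real)" using ln_le_minus_one[of "2::real"] by simp
    have "ln (64::real) = ln (2 ^ 6)" by simp
    also have "\<dots> = 6 * ln 2" by (subst ln_realpow) auto
    finally have l64: "ln (64::real) \<le> 6" using l2 by simp
    have "ln 3 \<le> (2::real)" using ln_le_minus_one[of "3::real"] by simp
    then have l3: "(real r - 1) * ln 3 \<le> (real r - 1) * 2" using r by (intro mult_left_mono) auto
    have lm: "ln (1 + \<mu> / 2) \<le> 1" using ln_le_minus_one[of "1 + \<mu> / 2"] \<mu> by simp
    have "ln w \<le> \<mu> / 24 / 2 * w" using z(4) w z(2) by (auto simp: b_def)
    moreover have "5 * real r \<le> \<mu> / 24 / 2 * w"
    proof -
      have "10 * real r \<le> (\<mu> / 24 * b) * real r" using z(3) by (intro mult_right_mono) (auto simp: b_def)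
      also have "\<dots> = \<mu> / 24 * (real r * b)" by simp
      also have "\<dots> \<le> \<mu> / 24 * w" using w \<mu> by (intro mult_left_mono) auto
      finally show ?thesis by simp
    qed
    moreover have "3 \<le> real r" using r by simp
    ultimately show ?thesis using l2 l64 l3 lm by (simp add: algebra_simps)
  qed
  finally have "ln (64 * exp 1 * real n / t) \<le> w - 2 * b + \<mu> / 24 * w" by simp
  then have "t * ln (64 * exp 1 * real n / t) \<le> t * (w - 2 * b + \<mu> / 24 * w)"
    using t0 by (intro mult_left_mono) auto
  also have "\<dots> = ln d * (1 + \<mu> / 24 - 2 * b / w) / (1 + \<mu> / 2)"
    using w \<mu> by (simp add: t_def threshold_def w_def[symmetric] field_simps)
  finally show ?thesis
    using n1 t0 by (simp add: loss_def ln_powr t_def n_def w_def b_def)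
qed

lemma loss_pos: "0 < loss \<mu> d r e"
  using threshold_bounds forcing_size_gt by (auto simp: loss_def forcing_size_def)

text \<open>\<open>loss\<close> is at most \<open>d\<close>, whereas
  \<open>4 ^ set_size d \<ge> exp (2 * ln d) = d * d\<close>. The 2 in \<open>set_size\<close> thus
  leaves a whole factor \<open>d\<close> for the constants.\<close>

lemma loss_le: "8 * loss \<mu> d r e \<le> \<mu> / 16 * 4 ^ set_size d"
proof -
  have "ln (loss \<mu> d r e) \<le> ln d * (1 + \<mu> / 24 - 2 * ln (ln d) / weight d r e) / (1 + \<mu> / 2)"
    by (rule ln_loss_le)
  also have "\<dots> \<le> ln d * (1 + \<mu> / 2) / (1 + \<mu> / 2)"
  proof (intro divide_right_mono mult_left_mono)
    have "0 \<le> 2 * ln (ln d) / weight d r e" using z weight_ge by (intro divide_nonneg_nonneg) linarith+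
    then show "1 + \<mu> / 24 - 2 * ln (ln d) / weight d r e \<le> 1 + \<mu> / 2" using \<mu> by linarith
  qed (use z \<mu> in auto)
  also have "\<dots> = ln d" using \<mu> by simp
  finally have "loss \<mu> d r e \<le> d" using loss_pos d by simp
  moreover have "8 \<le> \<mu> / 16 * d" using z(5) d by simp
  then have "8 * d \<le> \<mu> / 16 * d * d" using d by (intro mult_right_mono) auto
  moreover have "d * d \<le> 4 ^ set_size d"
  proof -
    have "d * d = exp (2 * ln d)" using d by (simp add: exp_double power2_eq_square)
    also have "\<dots> \<le> exp (real (set_size d))" using set_size_bounds by simp
    also have "\<dots> = exp 1 ^ set_size d" by (simp add: exp_of_nat_mult[symmetric])
    also have "\<dots> \<le> 4 ^ set_size d" using exp_le by (intro power_mono) auto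
    finally show ?thesis .
  qed
  then have "\<mu> / 16 * (d * d) \<le> \<mu> / 16 * 4 ^ set_size d" using \<mu> by (intro mult_left_mono) auto
  ultimately show ?thesis by (simp add: mult.assoc)
qed

text \<open>With \<open>Y = d * weight / ln d\<close> the list has at least
  \<open>(1 + \<mu>) * Y\<close> colours, while \<open>d / threshold = (1 + \<mu> / 2) * Y\<close>.
  The gap pays for the two factors \<open>1 - \<mu> / 16\<close> and for the second summand, which
  is at most \<open>\<mu> / 8 * Y\<close> because \<open>weight \<ge> 1\<close>.\<close>

lemma list_budget:
  assumes q: "(1 + \<mu>) * d * (e + real r * ln (ln d) / ln d) \<le> q"
  shows "d / ((1 - \<mu> / 16) * threshold \<mu> d r e) + 2 * ((\<mu> / 16)\<^sup>2 / ln d) * d / (\<mu> / 16) \<le> (1 - \<mu> / 16) * q"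
    and "d / ln d \<le> q"
proof -
  define Y where "Y = d * weight d r e / ln d"
  have w: "3 \<le> weight d r e" by (rule weight_ge)
  have "d * 1 / ln d \<le> Y" unfolding Y_def using w d_ge_1 by (intro divide_right_mono mult_left_mono) auto
  moreover have "0 < d / ln d" using d z by (intro divide_pos_pos) linarith+
  ultimately have Y: "d / ln d \<le> Y" "0 < Y" by auto
  have "(1 + \<mu>) * d * (e + real r * ln (ln d) / ln d) = (1 + \<mu>) * Y"
    using z by (simp add: Y_def weight_def field_simps)
  then have qY: "(1 + \<mu>) * Y \<le> q" using q by (simp only:)
  have "1 * Y \<le> (1 + \<mu>) * Y" using Y \<mu> by (intro mult_right_mono) auto
  then show "d / ln d \<le> q" using qY Y by linarith
  have "d / ((1 - \<mu> / 16) * threshold \<mu> d r e) = (1 + \<mu> / 2) / (1 - \<mu> / 16) * Y"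
    using z \<mu> w by (simp add: threshold_def Y_def field_simps)
  moreover have "2 * ((\<mu> / 16)\<^sup>2 / ln d) * d / (\<mu> / 16) = 2 * (\<mu> / 16) * (d / ln d)"
    using \<mu> by (simp add: power2_eq_square field_simps)
  moreover have "2 * (\<mu> / 16) * (d / ln d) \<le> 2 * (\<mu> / 16) * Y" using Y \<mu> by (intro mult_left_mono) auto
  moreover have "(1 + \<mu> / 2) / (1 - \<mu> / 16) \<le> (1 - \<mu> / 16) * (1 + \<mu>) - 2 * (\<mu> / 16)"
  proof -
    have "\<mu> * \<mu> \<le> \<mu>" "0 \<le> \<mu> * \<mu> * \<mu>" using \<mu> by (auto simp: mult_left_le)
    moreover have "((1 - \<mu> / 16) * (1 + \<mu>) - 2 * (\<mu> / 16)) * (1 - \<mu> / 16)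
        = 1 + 3 / 4 * \<mu> - 1 / 8 * (\<mu> * \<mu>) + 3 / 256 * (\<mu> * \<mu>) + 1 / 256 * (\<mu> * \<mu> * \<mu>)"
      by (simp add: field_simps)
    ultimately have "1 + \<mu> / 2 \<le> ((1 - \<mu> / 16) * (1 + \<mu>) - 2 * (\<mu> / 16)) * (1 - \<mu> / 16)"
      using \<mu> by linarith
    then show ?thesis using \<mu> by (subst pos_divide_le_eq) auto
  qed
  then have "(1 + \<mu> / 2) / (1 - \<mu> / 16) * Y \<le> ((1 - \<mu> / 16) * (1 + \<mu>) - 2 * (\<mu> / 16)) * Y"
    using Y by (intro mult_right_mono) auto
  moreover have "(1 - \<mu> / 16) * ((1 + \<mu>) * Y) \<le> (1 - \<mu> / 16) * q" using qY \<mu> by (intro mult_left_mono) auto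
  ultimately show "d / ((1 - \<mu> / 16) * threshold \<mu> d r e) + 2 * ((\<mu> / 16)\<^sup>2 / ln d) * d / (\<mu> / 16) \<le> (1 - \<mu> / 16) * q"
    by (simp add: algebra_simps)
qed

text \<open>When \<open>d\<close> is a power of \<open>ln D\<close>, the exponent \<open>em\<close> is so small that \<open>weight d r e\<close> is about
  \<open>r * ln (ln d)\<close>, and the gain \<open>2 / r\<close> in the exponent of \<open>loss\<close> pays for \<open>(ln D)\<^sup>2\<close>.\<close>

lemma loss_vs_max_degree:
  assumes D: "0 < D" "1 \<le> ln D" "1 \<le> ln (ln D)" "2 * (16 / \<mu>) * ln (ln D) < ln D"
      "(16 / \<mu>)\<^sup>2 * (ln (ln D))\<^sup>2 \<le> 2 * ln D"
    and em: "e \<le> em" "0 \<le> em"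
    and deg: "min (2 * em) ((1 + em) / 2) * ln D + real r * ln (ln D) \<le> ln d"
    and K: "ln (ln d) + K \<le> \<mu> / 24 * ln d"
  shows "ln (loss \<mu> d r e) \<le> ln d - 2 * ln (ln D) - ln (ln d) - K"
proof -
  define w where "w = weight d r e"
  define b where "b = ln (ln d)"
  define l where "l = ln (ln D)"
  have w: "3 * b \<le> w" "3 \<le> w" using weight_ge by (auto simp: w_def b_def)
  have b: "1 \<le> b" "10 \<le> \<mu> / 24 * b" using z by (auto simp: b_def)
  have pos: "0 < 1 + \<mu> / 2" using \<mu> by simp
  have main: "(2 * l + b + K) * (1 + \<mu> / 2) \<le> ln d * (\<mu> / 2 - \<mu> / 24 + 2 * b / w)"
  \<comment> \<open>If \<open>d\<close> is at least the power \<open>16 / \<mu>\<close> of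
    \<open>ln D\<close>, then \<open>2 * l \<le> \<mu> / 8 * ln d\<close>, and the slack
    \<open>1 + \<mu> / 2\<close> in \<open>threshold\<close> already suffices.\<close>
  proof (cases "16 / \<mu> * l \<le> ln d")
    case True
    then have "2 * l \<le> \<mu> / 8 * ln d" using \<mu> by (simp add: field_simps)
    moreover have "b + K \<le> \<mu> / 24 * ln d" using K by (simp add: b_def)
    ultimately have "2 * l + b + K \<le> \<mu> / 6 * ln d" by simp
    then have "(2 * l + b + K) * (1 + \<mu> / 2) \<le> \<mu> / 6 * ln d * (1 + \<mu> / 2)" using pos by (intro mult_right_mono) auto
    also have "\<dots> \<le> \<mu> / 6 * ln d * 2" using \<mu> z by (intro mult_left_mono) auto
    also have "\<dots> \<le> ln d * (\<mu> / 2 - \<mu> / 24)" using \<mu> z by (simp add: field_simps)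
    also have "\<dots> \<le> ln d * (\<mu> / 2 - \<mu> / 24 + 2 * b / w)" using z b w by (intro mult_left_mono) auto
    finally show ?thesis .
  next
    case False
    then have small: "ln d < 16 / \<mu> * l" by simp
    have l: "1 \<le> l" using D by (simp add: l_def)
    have lnD0: "0 \<le> ln D" by (rule order_trans[OF zero_le_one D(2)])
    have rl: "0 \<le> real r * l" using l by simp
    have mn: "min (2 * em) ((1 + em) / 2) * ln D \<le> 16 / \<mu> * l" using deg small rl by (simp add: l_def)
    \<comment> \<open>A minimum of \<open>(1 + em) / 2\<close> would make \<open>d\<close> at least
      the square root of \<open>D\<close>. So the minimum is \<open>2 * em\<close>, and
      \<open>em\<close> is of order \<open>ln (ln D) / ln D\<close>.\<close>
    have "\<not> (1 + em) / 2 \<le> 2 * em"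
    proof
      assume "(1 + em) / 2 \<le> 2 * em"
      then have "(1 + em) / 2 * ln D \<le> 16 / \<mu> * l" using mn by simp
      moreover have "1 / 2 * ln D \<le> (1 + em) / 2 * ln D" using em lnD0 by (intro mult_right_mono) simp_all
      ultimately show False using D(4) by (simp add: l_def)
    qed
    then have em2: "2 * em * ln D \<le> 16 / \<mu> * l" using mn by simp
    have "2 * ln D * (e * ln d) \<le> 2 * ln D * (em * ln d)"
      using em lnD0 z(1) by (intro mult_left_mono mult_right_mono) simp_all
    also have "\<dots> = (2 * em * ln D) * ln d" by simp
    also have "\<dots> \<le> (16 / \<mu> * l) * (16 / \<mu> * l)" by (rule mult_mono[OF em2]) (use small z(1) l \<mu> in auto)
    also have "\<dots> = (16 / \<mu>)\<^sup>2 * l\<^sup>2" by (simp add: power2_eq_square)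
    also have "\<dots> \<le> 2 * ln D * 1" using D by (simp add: l_def)
    finally have y: "e * ln d \<le> 1" using D by (simp only: mult_le_cancel_left_pos)
    have w1: "w \<le> 1 + real r * b" using y by (simp add: w_def weight_def b_def)
    have rb: "0 < real r * b" using r b by simp
    have r3: "3 \<le> real r" using r by simp
    have "2 / real r - \<mu> / 24 \<le> 2 * b / (1 + real r * b)"
    proof -
      have "2 / real r - 2 * b / (1 + real r * b) = 2 / (real r * (1 + real r * b))"
        using rb r3 by (simp add: field_simps)
      also have "\<dots> \<le> 2 / b"
      proof (rule divide_left_mono)
        have "1 * b \<le> real r * b" using r3 b by (intro mult_right_mono) auto
        then have "b \<le> 1 + real r * b" by simp
        then have "1 * b \<le> real r * (1 + real r * b)" using r3 b by (intro mult_mono) auto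
        then show "b \<le> real r * (1 + real r * b)" by simp
      qed (use b r3 in \<open>auto intro!: mult_pos_pos add_pos_pos\<close>)
      also have "\<dots> \<le> \<mu> / 24" using b by (simp add: field_simps)
      finally show ?thesis by simp
    qed
    also have "2 * b / (1 + real r * b) \<le> 2 * b / w" using w1 w b by (intro divide_left_mono) auto
    finally have bw: "2 / real r - \<mu> / 24 \<le> 2 * b / w" .
    have "0 \<le> min (2 * em) ((1 + em) / 2)" using em by simp
    from this lnD0 have "0 \<le> min (2 * em) ((1 + em) / 2) * ln D" by (rule mult_nonneg_nonneg)
    then have "real r * l \<le> ln d" using deg by (simp add: l_def)
    then have "2 * l \<le> 2 / real r * ln d" using r3 by (simp add: field_simps)
    moreover have "b + K \<le> \<mu> / 24 * ln d" using K by (simp add: b_def)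
    ultimately have "2 * l + b + K \<le> ln d * (2 / real r + \<mu> / 24)" by (simp add: algebra_simps)
    then have "(2 * l + b + K) * (1 + \<mu> / 2) \<le> ln d * (2 / real r + \<mu> / 24) * (1 + \<mu> / 2)"
      using pos by (intro mult_right_mono) auto
    also have "\<dots> = ln d * ((2 / real r + \<mu> / 24) * (1 + \<mu> / 2))" by simp
    also have "\<dots> \<le> ln d * (\<mu> / 2 - \<mu> / 24 + (2 / real r - \<mu> / 24))"
    proof (rule mult_left_mono)
      \<comment> \<open>There is little room: with \<open>r \<ge> 3\<close> the terms beyond
        \<open>2 / r\<close> on the left add up to at most \<open>19 / 48 * \<mu>\<close>, against
        \<open>20 / 48 * \<mu>\<close> on the right.\<close>
      have "\<mu> / real r \<le> \<mu> / 3" using r3 \<mu> by (intro divide_left_mono) auto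
      moreover have "\<mu> * \<mu> \<le> \<mu>" using \<mu> by (simp add: mult_left_le)
      moreover have "(2 / real r + \<mu> / 24) * (1 + \<mu> / 2)
          = 2 / real r + \<mu> / real r + 1 / 24 * \<mu> + 1 / 48 * (\<mu> * \<mu>)"
        by (simp add: algebra_simps)
      ultimately show "(2 / real r + \<mu> / 24) * (1 + \<mu> / 2) \<le> \<mu> / 2 - \<mu> / 24 + (2 / real r - \<mu> / 24)"
        using \<mu> by linarith
    qed (use z in auto)
    also have "\<dots> \<le> ln d * (\<mu> / 2 - \<mu> / 24 + 2 * b / w)" using bw z by (intro mult_left_mono) auto
    finally show ?thesis .
  qed
  have "ln d * (1 + \<mu> / 24 - 2 * b / w) = ln d * (1 + \<mu> / 2) - ln d * (\<mu> / 2 - \<mu> / 24 + 2 * b / w)"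
    by (simp add: algebra_simps)
  also have "\<dots> \<le> (ln d - (2 * l + b + K)) * (1 + \<mu> / 2)" using main by (simp add: algebra_simps)
  finally have "ln d * (1 + \<mu> / 24 - 2 * b / w) / (1 + \<mu> / 2) \<le> ln d - (2 * l + b + K)"
    using pos by (simp add: pos_divide_le_eq)
  then show ?thesis using ln_loss_le by (simp add: w_def b_def l_def)
qed

end

section \<open>Correspondence covers of locally sparse graphs\<close>

lemma neighborhood_with_proj: "neighborhood (with_proj G) v = {u. (v, u) \<in> parcs G}"
  by (simp add: neighborhood_def)

text \<open>\<open>subgraph\<close> fixes the tail and head maps, so a copy is determined by its
  vertices and arcs. Finiteness matters because \<open>card\<close> of an infinite set is 0, and a
  sparsity bound would then say nothing.\<close>

lemma finite_clique_copies:
  assumes "finite (verts G)" "finite (arcs G)"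
  shows "finite (clique_copies G r)"
proof (rule finite_subset)
  show "clique_copies G r \<subseteq> (\<lambda>(A, B). \<lparr>verts = A, arcs = B, tail = tail G, head = head G\<rparr>) ` (Pow (verts G) \<times> Pow (arcs G))"
  proof
    fix K assume "K \<in> clique_copies G r"
    then have "verts K \<subseteq> verts G" "arcs K \<subseteq> arcs G" "tail K = tail G" "head K = head G"
      by (auto simp: clique_copies_def subgraph_def compatible_def)
    then have "K = (\<lambda>(A, B). \<lparr>verts = A, arcs = B, tail = tail G, head = head G\<rparr>) (verts K, arcs K)"
      "(verts K, arcs K) \<in> Pow (verts G) \<times> Pow (arcs G)" by auto
    then show "K \<in> (\<lambda>(A, B). \<lparr>verts = A, arcs = B, tail = tail G, head = head G\<rparr>) ` (Pow (verts G) \<times> Pow (arcs G))"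
      by blast
  qed
qed (use assms in auto)

text \<open>Each vertex set \<open>K\<close> of a clique is sent to the digraph on \<open>K\<close>
  with all arcs between distinct vertices; it can be recovered from that copy.\<close>

lemma card_cliques_le_clique_copies:
  assumes G: "pair_graph G" and v: "v \<in> pverts G"
  shows "card {K. K \<subseteq> {u. (v, u) \<in> parcs G} \<and> card K = r \<and> pairwise (\<lambda>u w. (u, w) \<in> parcs G) K}
    \<le> card (clique_copies (with_proj G \<restriction> neighborhood (with_proj G) v) r)"
proof -
  interpret pair_graph G by fact
  let ?N = "{u. (v, u) \<in> parcs G}"
  let ?G = "with_proj G \<restriction> neighborhood (with_proj G) v"
  let ?K = "\<lambda>K. with_proj \<lparr>pverts = K, parcs = {(u, w). u \<in> K \<and> w \<in> K \<and> u \<noteq> w}\<rparr>"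
  have N: "?N \<subseteq> pverts G" by (auto dest: in_arcsD2)
  have finN: "finite ?N" using N pair_finite_verts finite_subset by blast
  have vG: "verts ?G = ?N" "tail ?G = fst" "head ?G = snd"
    and aG: "arcs ?G = {a \<in> parcs G. fst a \<in> ?N \<and> snd a \<in> ?N}"
    using N by (auto simp: neighborhood_with_proj induce_subgraph_def)
  have wfG: "wf_digraph ?G" by unfold_locales (auto simp: vG aG)
  have "finite (verts ?G)" unfolding vG by (rule finN)
  moreover have "finite (arcs ?G)" unfolding aG using pair_finite_arcs by simp
  ultimately have fin: "finite (clique_copies ?G r)" by (rule finite_clique_copies)
  show ?thesis
  proof (rule card_inj_on_le[OF _ _ fin])
    show "inj_on ?K {K. K \<subseteq> ?N \<and> card K = r \<and> pairwise (\<lambda>u w. (u, w) \<in> parcs G) K}"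
      by (rule inj_on_inverseI[where g = verts]) simp
    show "?K ` {K. K \<subseteq> ?N \<and> card K = r \<and> pairwise (\<lambda>u w. (u, w) \<in> parcs G) K} \<subseteq> clique_copies ?G r"
    proof (rule image_subsetI)
      fix K assume "K \<in> {K. K \<subseteq> ?N \<and> card K = r \<and> pairwise (\<lambda>u w. (u, w) \<in> parcs G) K}"
      then have K: "K \<subseteq> ?N" "card K = r" "pairwise (\<lambda>u w. (u, w) \<in> parcs G) K" by auto
      have finK: "finite K" using K finN finite_subset by blast
      have "complete_digraph r (?K K)"
        using K finK by (simp only: complete_digraph_pair_def) auto
      moreover have "subgraph (?K K) ?G"
      proof -
        have "wf_digraph (?K K)" by unfold_locales auto
        then show ?thesis
          using K wfG by (auto simp: subgraph_def compatible_def vG aG pairwise_def neighborhood_with_proj)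
      qed
      ultimately show "?K K \<in> clique_copies ?G r" by (simp add: clique_copies_def)
    qed
  qed
qed

lemma card_neighborhood:
  assumes "pair_graph G" "v \<in> pverts G"
  shows "card {u. (v, u) \<in> parcs G} = out_degree (with_proj G) v"
proof -
  have "out_arcs (with_proj G) v = Pair v ` {u. (v, u) \<in> parcs G}"
    by (auto simp: out_arcs_def)
  then show ?thesis by (simp add: out_degree_def card_image inj_on_def)
qed

lemma correspondence_coverD:
  assumes H: "correspondence_cover G L H"
  shows "pair_graph H"
    and "v \<in> pverts G \<Longrightarrow> L v \<noteq> {}" and "v \<in> pverts G \<Longrightarrow> L v \<subseteq> pverts H"
    and "(x, y) \<in> parcs H \<Longrightarrow> (y, x) \<in> parcs H"
    and "\<lbrakk>u \<in> pverts G; w \<in> pverts G; x \<in> L u; y \<in> L w; (x, y) \<in> parcs H\<rbrakk> \<Longrightarrow> (u, w) \<in> parcs G"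
    and "\<lbrakk>u \<in> pverts G; w \<in> pverts G; x \<in> L u; y \<in> L w; y' \<in> L w; (x, y) \<in> parcs H; (x, y') \<in> parcs H\<rbrakk> \<Longrightarrow> y = y'"
proof -
  show pg: "pair_graph H" using H by (simp add: correspondence_cover_def)
  interpret pair_graph H by fact
  show "v \<in> pverts G \<Longrightarrow> L v \<noteq> {}" "v \<in> pverts G \<Longrightarrow> L v \<subseteq> pverts H"
    using H by (auto simp: correspondence_cover_def)
  show sym: "(x, y) \<in> parcs H \<Longrightarrow> (y, x) \<in> parcs H" for x y
    using pair_sym_arcs by (auto simp: symmetric_def dest: symD)
  have edge: "{x, y} \<in> edge_set (with_proj H \<restriction> (L u \<union> L w))"
    if "x \<in> L u \<union> L w" "y \<in> L u \<union> L w" "(x, y) \<in> parcs H" for x y u w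
  proof -
    have "x \<rightarrow>\<^bsub>with_proj H \<restriction> (L u \<union> L w)\<^esub> y"
      using that by (force simp: induce_subgraph_def arcs_ends_def arc_to_ends_def)
    then show ?thesis unfolding edge_set_def by blast
  qed
  show "(u, w) \<in> parcs G"
    if "u \<in> pverts G" "w \<in> pverts G" "x \<in> L u" "y \<in> L w" "(x, y) \<in> parcs H"
    using edge[of x u w y] that H by (auto simp: correspondence_cover_def)
  show "y = y'"
    if a: "u \<in> pverts G" "w \<in> pverts G" "x \<in> L u" "y \<in> L w" "y' \<in> L w" "(x, y) \<in> parcs H" "(x, y') \<in> parcs H"
  proof (rule ccontr)
    assume ne: "y \<noteq> y'"
    have pw: "pairwise disjnt (edge_set (with_proj H \<restriction> (L u \<union> L w)))"
      using H a by (simp add: correspondence_cover_def)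
    have e: "{x, y} \<in> edge_set (with_proj H \<restriction> (L u \<union> L w))" "{x, y'} \<in> edge_set (with_proj H \<restriction> (L u \<union> L w))"
      using a by (auto intro!: edge)
    have "{x, y} \<noteq> {x, y'}" using ne by (auto simp: doubleton_eq_iff)
    then have "disjnt {x, y} {x, y'}" by (rule pairwiseD[OF pw e])
    then show False by simp
  qed
qed

lemma list_factor_ge_1:
  assumes "0 \<le> e" "e \<le> 1"
  shows "1 \<le> list_factor e"
proof (cases "e = 1")
  case False
  then have "1 \<le> (1 + e) / (1 - e)" using assms by (simp add: le_divide_eq)
  then show ?thesis using False by (simp add: list_factor_def)
qed (simp add: list_factor_def)

text \<open>The statement for one graph with explicit largeness conditions: \<open>z0\<close> marks
  where the estimates in \<open>ln (deg v)\<close> become valid, and the conditions on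
  \<open>D\<close> reach every vertex through the lower bound on degrees.\<close>

lemma max_degree_large_imp_colouring:
  fixes G :: "'a pair_pre_digraph" and H :: "'c pair_pre_digraph" and \<mu> :: real and D :: nat
  defines "deg \<equiv> \<lambda>v. real (out_degree (with_proj G) v)"
  assumes \<mu>: "0 < \<mu>" "\<mu> \<le> 1"
    and Z: "\<And>z. z0 \<le> z \<Longrightarrow> 5 \<le> z \<and> 1 \<le> ln z \<and> 10 \<le> \<mu> / 24 * ln z \<and> (\<forall>w\<ge>ln z. ln w \<le> \<mu> / 24 / 2 * w) \<and>
      8 \<le> \<mu> / 16 * exp z \<and> ln z + (ln 40 - 4 * ln (\<mu> / 16)) \<le> \<mu> / 24 * z"
    and D: "1 \<le> ln (real D)" "max 1 z0 \<le> ln (ln (real D))" "2 * (16 / \<mu>) * ln (ln (real D)) < ln (real D)"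
      "(16 / \<mu>)\<^sup>2 * (ln (ln (real D)))\<^sup>2 \<le> 2 * ln (real D)"
    and G: "pair_graph G" and sparse: "locally_sparse k r (with_proj G)"
    and em: "\<And>v. v \<in> pverts G \<Longrightarrow> 0 \<le> \<epsilon> v \<and> \<epsilon> v \<le> em" "0 \<le> em" "em \<le> 1"
    and rm: "\<And>v. v \<in> pverts G \<Longrightarrow> r v \<le> rm"
    and degD: "\<And>v. v \<in> pverts G \<Longrightarrow> deg v \<le> real D"
    and deg: "\<And>v. v \<in> pverts G \<Longrightarrow>
      real D powr min (2 * em) ((1 + em) / 2) * ln (8 * real D ^ 4) ^ rm \<le> deg v"
    and r3: "\<And>v. v \<in> pverts G \<Longrightarrow> 3 \<le> r v"
    and k: "\<And>v. v \<in> pverts G \<Longrightarrow> k v = deg v powr (\<epsilon> v * real (r v))"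
    and H: "correspondence_cover G L H"
    and lists: "\<And>v. v \<in> pverts G \<Longrightarrow>
      (1 + \<mu>) * deg v * (\<epsilon> v + real (r v) * ln (ln (deg v)) / ln (deg v)) \<le> real (card (L v))"
  shows "\<exists>\<phi>. proper_cover_coloring G L H \<phi>"
proof -
  interpret G: pair_graph G by fact
  let ?V = "pverts G" and ?E = "\<lambda>u w. (u, w) \<in> parcs G" and ?X = "\<lambda>x y. (x, y) \<in> parcs H"
  interpret H: pair_graph H using correspondence_coverD(1)[OF H] .
  interpret conflict_system ?V ?E L ?X
  proof
    show "finite ?V" by (rule G.pair_finite_verts)
    show "finite (L v)" if "v \<in> ?V" for v
      using finite_subset[OF correspondence_coverD(3)[OF H that] H.pair_finite_verts] .
    show "(v, v) \<notin> parcs G" for v using G.pair_no_loops by fastforce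
  qed (use correspondence_coverD[OF H] in blast)+
  define l where "l = ln (real D)"
  define b where "b = ln (8 * real D ^ 4)"
  have l: "1 \<le> l" "1 \<le> ln l" "z0 \<le> ln l" using D by (auto simp: l_def)
  have D0: "1 \<le> real D"
  proof (rule ccontr)
    assume "\<not> ?thesis"
    \<comment> \<open>\<open>ln 0 = 0\<close> in HOL, which contradicts
      \<open>1 \<le> l\<close>.\<close>
    then have "D = 0" by simp
    then show False using l by (simp add: l_def)
  qed
  have b: "1 \<le> b" "l \<le> b"
  proof -
    have "real D ^ 1 \<le> real D ^ 4" using D0 by (intro power_increasing) auto
    moreover have "0 \<le> real D ^ 4" by simp
    ultimately have "real D \<le> 8 * real D ^ 4" unfolding power_one_right by linarith
    then show "l \<le> b" using D0 by (simp add: l_def b_def)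
    then show "1 \<le> b" using l by linarith
  qed
  have pos: "0 < deg v" and lndeg: "min (2 * em) ((1 + em) / 2) * l + real (r v) * ln l \<le> ln (deg v)"
    if v: "v \<in> ?V" for v
  proof -
    let ?A = "real D powr min (2 * em) ((1 + em) / 2)" and ?B = "b ^ rm"
    have AB: "0 < ?A" "0 < ?B" using D0 b by auto
    have AB': "0 < ?A * ?B" using AB by (rule mult_pos_pos)
    have dv: "?A * ?B \<le> deg v" using deg[OF v] by (simp add: b_def)
    then show pos: "0 < deg v" using AB' by linarith
    have "ln l \<le> ln b" using b l by simp
    then have "real (r v) * ln l \<le> real rm * ln b"
      using rm[OF v] l by (intro mult_mono) auto
    then have "min (2 * em) ((1 + em) / 2) * l + real (r v) * ln l
        \<le> min (2 * em) ((1 + em) / 2) * l + real rm * ln b" by simp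
    also have "\<dots> = ln ?A + ln ?B" using D0 b by (simp add: ln_powr ln_realpow l_def)
    also have "\<dots> = ln (?A * ?B)" using AB by (rule ln_mult_pos[symmetric])
    also have "\<dots> \<le> ln (deg v)" using dv AB' pos by (simp only: ln_le_cancel_iff)
    finally show "min (2 * em) ((1 + em) / 2) * l + real (r v) * ln l \<le> ln (deg v)" .
  qed
  \<comment> \<open>Even for \<open>em = 0\<close> the logarithmic factor of the degree condition
    gives \<open>ln (deg v) \<ge> ln l\<close>, so a large maximum degree makes all degrees
    large.\<close>
  have z: "z0 \<le> ln (deg v)" if v: "v \<in> ?V" for v
  proof -
    have "0 \<le> min (2 * em) ((1 + em) / 2)" "0 \<le> l" using em(2) l by auto
    then have "0 \<le> min (2 * em) ((1 + em) / 2) * l" by (rule mult_nonneg_nonneg)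
    moreover have "1 * ln l \<le> real (r v) * ln l"
      using r3[OF v] l by (intro mult_right_mono) auto
    ultimately show ?thesis using lndeg[OF v] l by linarith
  qed
  note Zv = Z[OF z]
  define a where "a v = set_size (deg v)" for v
  define n where "n v = forcing_size (deg v) (r v) (\<epsilon> v)" for v
  define t where "t v = threshold \<mu> (deg v) (r v) (\<epsilon> v)" for v
  define Q where "Q v = loss \<mu> (deg v) (r v) (\<epsilon> v)" for v
  define \<delta> where "\<delta> = \<mu> / 16"
  \<comment> \<open>With this choice the neighbours with few available colours cost \<open>2 * \<xi>
    v * deg v / \<delta> = 2 * \<delta> * deg v / ln (deg v)\<close> colours, as
    \<open>list_budget\<close> allows.\<close>
  define \<xi> where "\<xi> v = \<delta>\<^sup>2 / ln (deg v)" for v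
  have \<delta>: "0 < \<delta>" "\<delta> < 1" using \<mu> by (auto simp: \<delta>_def)
  have "colourings L ?V \<noteq> {}"
  proof (rule colourings_nonempty[where d = deg and n = n and a = a and t = t and Q = Q and \<delta> = \<delta> and \<xi> = \<xi>])
    fix v assume v: "v \<in> ?V"
    have c: "0 < deg v" "0 \<le> \<epsilon> v" "3 \<le> r v" "5 \<le> ln (deg v)" "1 \<le> ln (ln (deg v))" "10 \<le> \<mu> / 24 * ln (ln (deg v))"
      "\<forall>w\<ge>ln (ln (deg v)). ln w \<le> \<mu> / 24 / 2 * w" "8 \<le> \<mu> / 16 * exp (ln (deg v))"
      using pos[OF v] em(1)[OF v] r3[OF v] Zv[OF v] by auto
    show "L v \<noteq> {}" using correspondence_coverD(2)[OF H v] .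
    have "{u \<in> ?V. ?E v u} = {u. ?E v u}" by (auto dest: G.in_arcsD2)
    then show "real (card {u \<in> ?V. ?E v u}) \<le> deg v"
      using card_neighborhood[OF G v] by (simp add: deg_def)
    show "1 \<le> n v" by (simp add: n_def forcing_size_def)
    show "0 < t v" "t v \<le> real (a v)" "t v \<le> 64 * real (n v)"
      using threshold_bounds[OF \<mu> c] by (auto simp: t_def a_def n_def)
    show "Q v = (64 * exp 1 * real (n v) / t v) powr t v" by (simp add: Q_def loss_def n_def t_def)
    show "8 * Q v \<le> \<delta> * 4 ^ a v" using loss_le[OF \<mu> c] by (simp add: Q_def \<delta>_def a_def)
    have lnv: "0 < ln (deg v)" by (rule less_le_trans[OF _ c(4)]) simp
    show \<xi>0: "0 \<le> \<xi> v" unfolding \<xi>_def using lnv by (intro divide_nonneg_nonneg) simp_all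
    show "deg v / ((1 - \<delta>) * t v) + 2 * \<xi> v * deg v / \<delta> \<le> (1 - \<delta>) * real (card (L v))"
      using list_budget(1)[OF \<mu> c lists[OF v]] by (simp add: \<delta>_def t_def \<xi>_def)
    show "\<exists>J\<subseteq>Y. card J = a v \<and> pairwise (\<lambda>u w. \<not> ?E u w) J"
      if Y: "Y \<subseteq> {u \<in> ?V. ?E v u}" "n v \<le> card Y" for Y
    proof -
      have finY: "finite Y" using Y G.pair_finite_verts by (auto intro: finite_subset)
      have x1: "1 \<le> deg v powr \<epsilon> v" using d_ge_1[OF \<mu> c] c(2) by (rule ge_one_powr_ge_zero)
      have fin: "finite {K. K \<subseteq> {u. ?E v u} \<and> card K = r v \<and> pairwise ?E K}"
      proof -
        have "{u. ?E v u} \<subseteq> ?V" by (auto dest: G.in_arcsD2)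
        then have "finite {u. ?E v u}" using G.pair_finite_verts by (rule finite_subset)
        then show ?thesis by simp
      qed
      have "card {K. K \<subseteq> Y \<and> card K = r v \<and> pairwise ?E K} \<le> card {K. K \<subseteq> {u. ?E v u} \<and> card K = r v \<and> pairwise ?E K}"
        using Y by (intro card_mono fin) auto
      also have "\<dots> \<le> card (clique_copies (with_proj G \<restriction> neighborhood (with_proj G) v) (r v))"
        by (rule card_cliques_le_clique_copies[OF G v])
      finally have "int (card {K. K \<subseteq> Y \<and> card K = r v \<and> pairwise ?E K})
          \<le> int (card (clique_copies (with_proj G \<restriction> neighborhood (with_proj G) v) (r v)))"
        by (simp only: of_nat_le_iff)
      also have "\<dots> \<le> \<lfloor>k v\<rfloor>" using sparse v by (simp add: locally_sparse_def sparse_def)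
      finally have "real (card {K. K \<subseteq> Y \<and> card K = r v \<and> pairwise ?E K}) \<le> k v" by linarith
      also have "k v = (deg v powr \<epsilon> v) ^ r v"
        using k[OF v] c(1) by (simp add: powr_powr[symmetric] powr_realpow)
      finally have few: "real (card {K. K \<subseteq> Y \<and> card K = r v \<and> pairwise ?E K}) \<le> (deg v powr \<epsilon> v) ^ r v" .
      have "symp ?E" by (rule sympI) (use G.pair_sym_arcs in \<open>auto simp: symmetric_def dest: symD\<close>)
      then show ?thesis
        using independent_of_few_cliques[OF finY, of ?E "r v" "a v" "deg v powr \<epsilon> v"] few x1 c(3)
          set_size_bounds(4)[OF \<mu> c] Y(2) forcing_size_gt[OF \<mu> c]
        by (auto simp: a_def n_def)
    qed
    fix u assume u: "u \<in> ?V"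
    have cu: "0 < deg u" "0 \<le> \<epsilon> u" "3 \<le> r u" "5 \<le> ln (deg u)" "1 \<le> ln (ln (deg u))" "10 \<le> \<mu> / 24 * ln (ln (deg u))"
      "\<forall>w\<ge>ln (ln (deg u)). ln w \<le> \<mu> / 24 / 2 * w" "8 \<le> \<mu> / 16 * exp (ln (deg u))"
      using pos[OF u] em(1)[OF u] r3[OF u] Zv[OF u] by auto
    let ?q = "real (card (L u))"
    have Q0: "0 < Q u" using loss_pos[OF \<mu> cu] by (simp add: Q_def)
    have lnu: "0 < ln (deg u)" by (rule less_le_trans[OF _ cu(4)]) simp
    have lQ: "ln (Q u) \<le> ln (deg u) - 2 * ln l - ln (ln (deg u)) - (ln 40 - 4 * ln \<delta>)"
      unfolding Q_def \<delta>_def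
      by (rule loss_vs_max_degree[OF \<mu> cu _ l(1,2)[unfolded l_def] D(3,4) _ em(2) lndeg[OF u, unfolded l_def], folded l_def])
        (use D0 em(1)[OF u] Zv[OF u] in auto)
    have bigq: "deg u / ln (deg u) \<le> ?q" using list_budget(2)[OF \<mu> cu lists[OF u]] .
    \<comment> \<open>Origin of 40: \<open>3 * a v + 2\<close> is at most \<open>10 * l\<close>, and
      \<open>\<xi> v \<ge> \<delta>\<^sup>2 / l\<close>, so the growth at \<open>u\<close> has to be
      at least \<open>10 * l\<^sup>2 / \<delta>\<^sup>2\<close>. Since the growth is
      \<open>\<delta>\<^sup>2 * ?q / (4 * Q u)\<close>, this means
      \<open>40 * l\<^sup>2 / \<delta> ^ 4 * Q u \<le> ?q\<close>.\<close>
    have "ln (40 * l\<^sup>2 / \<delta> ^ 4 * Q u) = ln 40 + 2 * ln l - 4 * ln \<delta> + ln (Q u)"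
      using l \<delta> Q0 by (simp add: ln_mult_pos ln_div ln_realpow)
    also have "\<dots> \<le> ln (deg u / ln (deg u))" unfolding ln_divide_pos[OF cu(1) lnu] using lQ by linarith
    finally have "ln (40 * l\<^sup>2 / \<delta> ^ 4 * Q u) \<le> ln (deg u / ln (deg u))" .
    moreover have "0 < 40 * l\<^sup>2 / \<delta> ^ 4 * Q u" using l \<delta> Q0 by simp
    moreover have "0 < deg u / ln (deg u)" using cu(1) lnu by (rule divide_pos_pos)
    ultimately have "40 * l\<^sup>2 / \<delta> ^ 4 * Q u \<le> deg u / ln (deg u)" by (simp only: ln_le_cancel_iff)
    then have "40 * l\<^sup>2 / \<delta> ^ 4 * Q u \<le> ?q" using bigq by linarith
    then have "10 * l\<^sup>2 / \<delta>\<^sup>2 \<le> \<delta>\<^sup>2 * ?q / (4 * Q u)"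
      using \<delta> Q0 by (simp add: field_simps power4_eq_xxxx power2_eq_square)
    then have "\<xi> v * (10 * l\<^sup>2 / \<delta>\<^sup>2) \<le> \<xi> v * (\<delta>\<^sup>2 * ?q / (4 * Q u))"
      using \<xi>0 by (intro mult_left_mono)
    moreover have "3 * real (a v) + 2 \<le> \<xi> v * (10 * l\<^sup>2 / \<delta>\<^sup>2)"
    proof -
      have lv: "ln (deg v) \<le> l" using degD[OF v] c(1) D0 by (simp add: l_def)
      have "3 * real (a v) + 2 \<le> 10 * l"
        using set_size_bounds(3)[OF \<mu> c] c(4) lv by (simp add: a_def)
      also have "\<dots> * ln (deg v) \<le> 10 * l * l" using lv l by (intro mult_left_mono) auto
      then have "10 * l \<le> 10 * l\<^sup>2 / ln (deg v)"
        by (simp add: pos_le_divide_eq[OF lnv] power2_eq_square)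
      also have "\<dots> = \<xi> v * (10 * l\<^sup>2 / \<delta>\<^sup>2)" using \<delta> by (simp add: \<xi>_def)
      finally show ?thesis .
    qed
    ultimately show "3 * real (a v) + 2 \<le> \<xi> v * (\<delta>\<^sup>2 * ?q / (4 * Q u))" by linarith
  qed (use \<delta> in auto)
  then obtain \<sigma> where \<sigma>: "\<sigma> \<in> colourings L ?V" by blast
  have "proper_cover_coloring G L H \<sigma>"
    unfolding proper_cover_coloring_def cover_coloring_def independent_set_def
    using colourings_in[OF \<sigma>] colourings_no_conflict[OF \<sigma>] subsetD[OF correspondence_coverD(3)[OF H]] by auto
  then show ?thesis by blast
qed

theorem theorem1p9:
  shows "\<exists>\<rho>::real. \<rho> > 0 \<and> (\<forall>\<mu>::real. \<mu> > 0 \<longrightarrow> (\<exists>D::nat. \<forall>\<Delta>\<^sub>0\<ge>D.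
    \<forall>(G :: 'a pair_pre_digraph) (k :: 'a \<Rightarrow> real) (r :: 'a \<Rightarrow> nat) (\<epsilon> :: 'a \<Rightarrow> real)
      (\<Delta> :: nat) (\<epsilon>\<^sub>m\<^sub>a\<^sub>x :: real) (r\<^sub>m\<^sub>a\<^sub>x :: nat).
      pair_graph G \<longrightarrow>
      \<Delta> = max_degree (with_proj G) \<longrightarrow>
      \<Delta> \<ge> \<Delta>\<^sub>0 \<longrightarrow>
      (\<forall>v\<in>pverts G. \<epsilon> v \<in> {0..1}) \<longrightarrow>
      locally_sparse k r (with_proj G) \<longrightarrow>
      \<epsilon>\<^sub>m\<^sub>a\<^sub>x = Max (\<epsilon> ` pverts G) \<longrightarrow>
      r\<^sub>m\<^sub>a\<^sub>x = Max (r ` pverts G) \<longrightarrow>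
      (\<forall>v\<in>pverts G. let d = real (out_degree (with_proj G) v) in
         d \<ge> real \<Delta> powr min (2 * \<epsilon>\<^sub>m\<^sub>a\<^sub>x) ((1 + \<epsilon>\<^sub>m\<^sub>a\<^sub>x) / 2) * ln (8 * real \<Delta> ^ 4) ^ r\<^sub>m\<^sub>a\<^sub>x \<and>
         3 \<le> r v \<and>
         real (r v) \<le> \<rho> * ln (ln d) / ln (ln (ln d)) \<and>
         k v = d powr (\<epsilon> v * real (r v))) \<longrightarrow>
      (\<forall>(L :: 'a \<Rightarrow> 'c set) (H :: 'c pair_pre_digraph).
         correspondence_cover G L H \<longrightarrow>
         (\<forall>u\<in>pverts G. let d = real (out_degree (with_proj G) u) in
            real (card (L u)) \<ge>
              (1 + \<mu>) * list_factor \<epsilon>\<^sub>m\<^sub>a\<^sub>x * d * (\<epsilon> u + real (r u) * ln (ln d) / ln d)) \<longrightarrow>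
         (\<exists>\<phi>. proper_cover_coloring G L H \<phi>))))"
proof (rule exI[of _ "1::real"], intro conjI allI impI, goal_cases)
  case 1
  show ?case by simp
next
  case (2 \<mu>)
  \<comment> \<open>Lowering \<open>\<mu>\<close> to at most 1 only weakens the demand on the lists,
    and the parameter estimates are made for \<open>\<mu> \<le> 1\<close>.\<close>
  define m where "m = min \<mu> 1"
  have m: "0 < m" "m \<le> 1" "m \<le> \<mu>" using 2 by (auto simp: m_def)
  obtain z0 where z0: "\<And>z. z0 \<le> z \<Longrightarrow> 5 \<le> z \<and> 1 \<le> ln z \<and> 10 \<le> m / 24 * ln z \<and> (\<forall>w\<ge>ln z. ln w \<le> m / 24 / 2 * w) \<and>
      8 \<le> m / 16 * exp z \<and> ln z + (ln 40 - 4 * ln (m / 16)) \<le> m / 24 * z"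
    using eventually_large_degree[of m "m / 16" "m / 24" "ln 40 - 4 * ln (m / 16)"] m
    unfolding eventually_at_top_linorder by auto
  obtain D0 where D0: "\<And>D. D0 \<le> D \<Longrightarrow> 1 \<le> ln D \<and> max 1 z0 \<le> ln (ln D) \<and> 2 * (16 / m) * ln (ln D) < ln D \<and>
      (16 / m)\<^sup>2 * (ln (ln D))\<^sup>2 \<le> 2 * ln D"
    using eventually_large_max_degree[of "16 / m" "max 1 z0"] m
    unfolding eventually_at_top_linorder by auto
  show ?case
  proof (intro exI[of _ "nat \<lceil>D0\<rceil>"] allI impI)
    fix \<Delta>\<^sub>0 :: nat and G :: "'a pair_pre_digraph" and k r \<epsilon> \<Delta> em rm
      and L :: "'a \<Rightarrow> 'c set" and H :: "'c pair_pre_digraph"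
    assume \<Delta>0: "nat \<lceil>D0\<rceil> \<le> \<Delta>\<^sub>0" and G: "pair_graph G" and \<Delta>: "\<Delta> = max_degree (with_proj G)" "\<Delta>\<^sub>0 \<le> \<Delta>"
      and \<epsilon>: "\<forall>v\<in>pverts G. \<epsilon> v \<in> {0..1}" and sparse: "locally_sparse k r (with_proj G)"
      and em: "em = Max (\<epsilon> ` pverts G)" and rm: "rm = Max (r ` pverts G)"
      and v: "\<forall>v\<in>pverts G. let d = real (out_degree (with_proj G) v) in
         d \<ge> real \<Delta> powr min (2 * em) ((1 + em) / 2) * ln (8 * real \<Delta> ^ 4) ^ rm \<and>
         3 \<le> r v \<and> real (r v) \<le> 1 * ln (ln d) / ln (ln (ln d)) \<and> k v = d powr (\<epsilon> v * real (r v))"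
      and H: "correspondence_cover G L H"
      and L: "\<forall>u\<in>pverts G. let d = real (out_degree (with_proj G) u) in
            real (card (L u)) \<ge> (1 + \<mu>) * list_factor em * d * (\<epsilon> u + real (r u) * ln (ln d) / ln d)"
    interpret pair_graph G by fact
    show "\<exists>\<phi>. proper_cover_coloring G L H \<phi>"
    proof (cases "pverts G = {}")
      case True
      then show ?thesis by (simp add: proper_cover_coloring_def cover_coloring_def independent_set_def)
    next
      case False
      have "D0 \<le> real \<Delta>" using \<Delta>0 \<Delta>(2) by linarith
      note D = D0[OF this]
      have em_in: "em \<in> \<epsilon> ` pverts G" unfolding em using False pair_finite_verts by (intro Max_in) auto
      then have em01: "0 \<le> em" "em \<le> 1" using \<epsilon> by auto
      show ?thesis
      proof (rule max_degree_large_imp_colouring[where \<mu> = m and D = \<Delta> and k = k and r = r and \<epsilon> = \<epsilon> and em = em and rm = rm and ?z0.0 = z0])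
        fix u assume u: "u \<in> pverts G"
        let ?d = "real (out_degree (with_proj G) u)"
        show "0 \<le> \<epsilon> u \<and> \<epsilon> u \<le> em" using \<epsilon> u pair_finite_verts by (auto simp: em)
        show "r u \<le> rm" using u pair_finite_verts by (auto simp: rm)
        show "?d \<le> real \<Delta>" using u pair_finite_verts by (auto simp: \<Delta>(1) max_degree_def)
        show deg: "real \<Delta> powr min (2 * em) ((1 + em) / 2) * ln (8 * real \<Delta> ^ 4) ^ rm \<le> ?d"
          and r3: "3 \<le> r u" and "k u = ?d powr (\<epsilon> u * real (r u))"
          using v u by (auto simp: Let_def)
        show "(1 + m) * ?d * (\<epsilon> u + real (r u) * ln (ln ?d) / ln ?d) \<le> real (card (L u))"
        \<comment> \<open>The factors can only be compared when the bracket is nonnegative, and its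
          sign is not established here: \<open>ln (ln ?d)\<close> is negative at
          \<open>?d = 2\<close>.\<close>
        proof (cases "0 \<le> \<epsilon> u + real (r u) * ln (ln ?d) / ln ?d")
          case True
          have "(1 + m) * 1 \<le> (1 + \<mu>) * list_factor em"
            using m list_factor_ge_1[OF em01] by (intro mult_mono) auto
          then have "(1 + m) * (?d * (\<epsilon> u + real (r u) * ln (ln ?d) / ln ?d))
              \<le> (1 + \<mu>) * list_factor em * (?d * (\<epsilon> u + real (r u) * ln (ln ?d) / ln ?d))"
            using True by (intro mult_right_mono) auto
          also have "\<dots> \<le> real (card (L u))" using L u by (simp add: Let_def mult.assoc)
          finally show ?thesis by (simp only: mult.assoc)
        next
          case False
          then have "(1 + m) * ?d * (\<epsilon> u + real (r u) * ln (ln ?d) / ln ?d) \<le> 0"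
            using m by (intro mult_nonneg_nonpos) auto
          then show ?thesis by (rule order_trans) simp
        qed
      qed (use m z0 D G sparse em01 H in auto)
    qed
  qed
qed

end
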